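(* Let $\alpha>1$ and $p,q>0$. (1) If $p/q\le\alpha$, then $SG_{\alpha,p}(A,B)\prec_{\log}R_{\alpha,q}(A,B)$ holds for all $A,B\ge0$ with $s(A)\ge s(B)$. (2) For any $\alpha>1$ and any $p,q>0$ there exist $A,B\in\mathbb{M}_2^{++}$ such that $R_{\alpha,q}(A,B)\not\prec_{\log}SG_{\alpha,p}(A,B)$.
   Context: Notation: $\mathbb{M}_n$ is the set of $n\times n$ complex matrices, $\mathbb{M}_n^+$ (resp. $\mathbb{M}_n^{++}$) the positive semidefinite (resp. positive definite) ones. $A\ge0$ (resp. $A>0$) means $A\in\mathbb{M}_n^+$ (resp. $A\in\mathbb{M}_n^{++}$) for some $n\in\mathbb{N}$; matrices appearing together have the same size. $s(A)$ is the support projection of $A\ge0$. $A^{-1}$ denotes the generalized inverse (the inverse on the support of $A$, zero on the kernel), and $A^r:=(A^{-1})^{-r}$ for $r<0$. For $A,B\ge0$ with $s(A)\ge s(B)$, $A\#B:=A^{1/2}(A^{-1/2}BA^{-1/2})^{1/2}A^{1/2}$. The quasi $\alpha$-weighted spectral geometric mean is, for $s(A)\ge s(B)$, $SG_{\alpha,p}(A,B):=\bigl((A^{-p}\#B^p)^{\alpha}A^p(A^{-p}\#B^p)^{\alpha}\bigr)^{1/p}$. The Rényi mean is, for $s(A)\ge s(B)$, $R_{\alpha,p}(A,B):=\bigl(A^{\frac{1-\alpha}{2}p}B^{\alpha p}A^{\frac{1-\alpha}{2}p}\bigr)^{1/p}$. Log-majorization: for $X,Y\in\mathbb{M}_n^+$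 with eigenvalues $\lambda_1(\cdot)\ge\dots\ge\lambda_n(\cdot)$ counted with multiplicity, $X\prec_{\log}Y$ means $\prod_{i=1}^k\lambda_i(X)\le\prod_{i=1}^k\lambda_i(Y)$ for $1\le k\le n$, with equality for $k=n$. *)

theory Defs
  imports
    "Jordan_Normal_Form.Schur_Decomposition"
    "Jordan_Normal_Form.Char_Poly"
begin

(* The order on complex is the one of HOL-Library.Complex_Order: 0 \<le> z means that z is real and
   nonnegative, so the quadratic form condition already forces A to be Hermitian. *)
definition psd_mat :: "nat \<Rightarrow> complex mat set" where
  "psd_mat n = {A \<in> carrier_mat n n. \<forall>v \<in> carrier_vec n. 0 \<le> (A *\<^sub>v v) \<bullet>c v}"

definition pd_mat :: "nat \<Rightarrow> complex mat set" where
  "pd_mat n = {A \<in> carrier_mat n n. \<forall>v \<in> carrier_vec n. v \<noteq> 0\<^sub>v n \<longrightarrow> 0 < (A *\<^sub>v v) \<bullet>c v}"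

(* Functional calculus f(A) = U diag(f(d_0), ..., f(d_{n-1})) U* for a Hermitian matrix
   A = U diag(d_0, ..., d_{n-1}) U* with U unitary; the result does not depend on the chosen
   diagonalization. Unspecified if A is not Hermitian. *)
definition mat_fun :: "(real \<Rightarrow> real) \<Rightarrow> complex mat \<Rightarrow> complex mat" where
  "mat_fun f A = (THE C. \<exists>U d.
     U \<in> carrier_mat (dim_row A) (dim_row A) \<and>
     mat_adjoint U * U = 1\<^sub>m (dim_row A) \<and>
     A = U * mat_diag (dim_row A) (\<lambda>i. complex_of_real (d i)) * mat_adjoint U \<and>
     C = U * mat_diag (dim_row A) (\<lambda>i. complex_of_real (f (d i))) * mat_adjoint U)"

(* As inverse 0 = 0 in HOL, this is the inverse on the support of A and zero on its kernel. *)
definition gen_inv :: "complex mat \<Rightarrow> complex mat" where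
  "gen_inv A = mat_fun inverse A"

(* 0 powr r = 0 for every r; in particular mat_powr A 0 is the support projection of A. *)
definition mat_powr :: "complex mat \<Rightarrow> real \<Rightarrow> complex mat" (infixr "^\<^sub>M" 80) where
  "A ^\<^sub>M r = (if r < 0 then mat_fun (\<lambda>x. x powr (- r)) (gen_inv A)
              else mat_fun (\<lambda>x. x powr r) A)"

(* The orthogonal projection onto the range of A. *)
definition support_proj :: "complex mat \<Rightarrow> complex mat" where
  "support_proj A = (THE P. P \<in> carrier_mat (dim_row A) (dim_row A) \<and>
     mat_adjoint P = P \<and> P * P = P \<and>
     (\<lambda>v. P *\<^sub>v v) ` carrier_vec (dim_row A) = (\<lambda>v. A *\<^sub>v v) ` carrier_vec (dim_row A))"

definition support_ge :: "complex mat \<Rightarrow> complex mat \<Rightarrow> bool" where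
  "support_ge A B \<longleftrightarrow> support_proj A - support_proj B \<in> psd_mat (dim_row A)"

definition geom_mean :: "complex mat \<Rightarrow> complex mat \<Rightarrow> complex mat" (infixl "#\<^sub>M" 75) where
  "A #\<^sub>M B = A ^\<^sub>M (1/2) * (A ^\<^sub>M (-1/2) * B * A ^\<^sub>M (-1/2)) ^\<^sub>M (1/2) * A ^\<^sub>M (1/2)"

definition SG_mean :: "real \<Rightarrow> real \<Rightarrow> complex mat \<Rightarrow> complex mat \<Rightarrow> complex mat" where
  "SG_mean \<alpha> p A B =
     ((A ^\<^sub>M (- p) #\<^sub>M B ^\<^sub>M p) ^\<^sub>M \<alpha> * A ^\<^sub>M p * (A ^\<^sub>M (- p) #\<^sub>M B ^\<^sub>M p) ^\<^sub>M \<alpha>) ^\<^sub>M (1 / p)"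

definition Renyi_mean :: "real \<Rightarrow> real \<Rightarrow> complex mat \<Rightarrow> complex mat \<Rightarrow> complex mat" where
  "Renyi_mean \<alpha> p A B =
     (A ^\<^sub>M ((1 - \<alpha>) / 2 * p) * B ^\<^sub>M (\<alpha> * p) * A ^\<^sub>M ((1 - \<alpha>) / 2 * p)) ^\<^sub>M (1 / p)"

(* The eigenvalues with algebraic multiplicity, in decreasing order. Taking real parts is harmless:
   the definition is meant for positive semidefinite X, whose eigenvalues are real. *)
definition eigvals_desc :: "complex mat \<Rightarrow> real list" where
  "eigvals_desc X = rev (sorted_list_of_multiset (image_mset Re (proots (char_poly X))))"

(* Indexed from 1, for 1 \<le> i \<le> dim_row X. *)
definition eigval :: "complex mat \<Rightarrow> nat \<Rightarrow> real" where
  "eigval X i = eigvals_desc X ! (i - 1)"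

(* Meant for positive semidefinite X and Y of the same size. *)
definition log_majorized :: "complex mat \<Rightarrow> complex mat \<Rightarrow> bool" (infix "\<prec>\<^sub>l\<^sub>o\<^sub>g" 50) where
  "X \<prec>\<^sub>l\<^sub>o\<^sub>g Y \<longleftrightarrow>
     (\<forall>k \<in> {1..dim_row X}. (\<Prod>i=1..k. eigval X i) \<le> (\<Prod>i=1..k. eigval Y i)) \<and>
     (\<Prod>i=1..dim_row X. eigval X i) = (\<Prod>i=1..dim_row X. eigval Y i)"

end

theory Submission
  imports Defs
begin

text \<open>
  For fixed \<open>k\<close> let \<open>N\<close> be the norm of the \<open>k\<close>-th exterior power; by Cauchy-Binet it is
  submultiplicative, so log-majorization reduces to norm inequalities for \<open>N\<close>. Submultiplicativity
  and the power trick make \<open>s \<mapsto> N (X\<^sup>s K Y\<^sup>s)\<close> midpoint log-convex for positive semidefinite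
  \<open>X\<close>, \<open>Y\<close>, which gives the Cordes inequality \<open>N (X\<^sup>t Y\<^sup>t) \<le> N (X Y)\<^sup>t\<close> for \<open>0 < t \<le> 1\<close>.

  Let \<open>G = A\<^sup>-\<^sup>p # B\<^sup>p\<close> and \<open>T = A\<^sup>e\<close> with \<open>e = p / (2\<alpha>)\<close>. The Riccati equation
  \<open>G A\<^sup>p G = B\<^sup>p\<close> turns the Cordes inequality (this is where \<open>p / q \<le> \<alpha>\<close> enters) into a bound of
  \<open>c = N (T\<^sup>s G T\<^sup>1\<^sup>-\<^sup>s)\<close> at \<open>s = 1 - \<alpha>\<close> by a power of the norm of the Renyi mean. By symmetry the
  same value is taken at \<open>s = \<alpha>\<close>, and interpolation gives the bound \<open>c\<close> in between. Multiplying
  these factors for \<open>s = \<alpha>, \<alpha> - 1, \<dots>\<close> yields \<open>N (T\<^sup>\<alpha> G\<^sup>\<alpha>) \<le> c\<^sup>\<alpha>\<close>, and \<open>N (T\<^sup>\<alpha> G\<^sup>\<alpha>)\<^sup>2\<close> is the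
  norm of the \<open>p\<close>-th power of the spectral geometric mean. Since powers of \<open>A\<close> are taken on its
  support, invertibility is never needed.
\<close>

section \<open>Unitary triangularization\<close>

abbreviation adj :: "complex mat \<Rightarrow> complex mat" ("_\<^sup>H" [1000] 999) where
  "A\<^sup>H \<equiv> mat_adjoint A"

abbreviation rdiag :: "nat \<Rightarrow> (nat \<Rightarrow> real) \<Rightarrow> complex mat" where
  "rdiag n d \<equiv> mat_diag n (\<lambda>i. complex_of_real (d i))"

lemma adjoint_dim [simp]: "dim_row (A\<^sup>H) = dim_col A" "dim_col (A\<^sup>H) = dim_row A"
  by (auto simp: mat_adjoint_def)

lemma adjoint_carrier [simp]: "A \<in> carrier_mat n m \<Longrightarrow> A\<^sup>H \<in> carrier_mat m n"
  by (intro carrier_matI) auto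

lemma adjoint_index [simp]: "i < dim_col A \<Longrightarrow> j < dim_row A \<Longrightarrow> A\<^sup>H $$ (i, j) = cnj (A $$ (j, i))"
  by (auto simp: mat_adjoint_def mat_of_rows_def)

lemma adjoint_adjoint [simp]: "(A\<^sup>H)\<^sup>H = A"
  by (rule eq_matI) auto

lemma adjoint_mult: "A \<in> carrier_mat n m \<Longrightarrow> B \<in> carrier_mat m k \<Longrightarrow> (A * B)\<^sup>H = B\<^sup>H * A\<^sup>H"
  by (rule eq_matI) (auto simp: scalar_prod_def mult.commute intro!: sum.cong)

lemma adjoint_one [simp]: "(1\<^sub>m n)\<^sup>H = (1\<^sub>m n :: complex mat)"
  by (rule eq_matI) auto

lemma adjoint_rdiag [simp]: "(rdiag n d)\<^sup>H = rdiag n d"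
  by (rule eq_matI) (auto simp: mat_diag_def)

lemma square_left_mult_carrier [simp]:
  "A \<in> carrier_mat n n \<Longrightarrow> B \<in> carrier_mat n m \<Longrightarrow> A * B \<in> carrier_mat n m"
  by auto

lemma square_mult_assoc:
  "A \<in> carrier_mat n n \<Longrightarrow> B \<in> carrier_mat n n \<Longrightarrow> C \<in> carrier_mat n n \<Longrightarrow> A * B * C = A * (B * C)"
  by (rule assoc_mult_mat)

lemma mult_mat_vec_adjoint:
  assumes "A \<in> carrier_mat n m" "v \<in> carrier_vec m" "w \<in> carrier_vec n"
  shows "(A *\<^sub>v v) \<bullet>c w = v \<bullet>c (A\<^sup>H *\<^sub>v w)"
proof -
  have "(A *\<^sub>v v) \<bullet>c w = (\<Sum>i<n. \<Sum>j<m. A $$ (i, j) * v $ j * cnj (w $ i))"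
    using assms by (auto simp: scalar_prod_def sum_distrib_right atLeast0LessThan)
  also have "\<dots> = (\<Sum>j<m. \<Sum>i<n. A $$ (i, j) * v $ j * cnj (w $ i))"
    by (rule sum.swap)
  also have "\<dots> = v \<bullet>c (A\<^sup>H *\<^sub>v w)"
    using assms by (auto simp: scalar_prod_def sum_distrib_left atLeast0LessThan mult_ac intro!: sum.cong)
  finally show ?thesis .
qed

section \<open>Positive semidefinite matrices\<close>

lemma psd_congruence:
  assumes "A \<in> psd_mat n" "W \<in> carrier_mat n m"
  shows "W\<^sup>H * A * W \<in> psd_mat m"
proof -
  have A: "A \<in> carrier_mat n n" using assms by (auto simp: psd_mat_def)
  have "0 \<le> ((W\<^sup>H * A * W) *\<^sub>v v) \<bullet>c v" if v: "v \<in> carrier_vec m" for v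
  proof -
    have "((W\<^sup>H * A * W) *\<^sub>v v) \<bullet>c v = (W\<^sup>H *\<^sub>v (A *\<^sub>v (W *\<^sub>v v))) \<bullet>c v"
      using A assms v by (simp add: assoc_mult_mat_vec[of "W\<^sup>H * A" m n W m] assoc_mult_mat_vec[of "W\<^sup>H" m n A n]
          mult_mat_vec_carrier[of _ n] mult_carrier_mat[of _ m n])
    also have "\<dots> = (A *\<^sub>v (W *\<^sub>v v)) \<bullet>c (W *\<^sub>v v)"
      using A assms v by (subst mult_mat_vec_adjoint[of _ m n]) (auto intro: mult_mat_vec_carrier)
    finally show ?thesis using assms v by (auto simp: psd_mat_def intro: mult_mat_vec_carrier)
  qed
  with A assms show ?thesis by (auto simp: psd_mat_def)
qed

lemma psd_one [simp]: "1\<^sub>m n \<in> psd_mat n"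
  by (auto simp: psd_mat_def conjugate_square_ge_0_vec)

lemma psd_gram: "M \<in> carrier_mat m n \<Longrightarrow> M\<^sup>H * M \<in> psd_mat n"
  using psd_congruence[OF psd_one, of M m n] by simp

lemma psd_carrier [simp]: "A \<in> psd_mat n \<Longrightarrow> A \<in> carrier_mat n n"
  by (auto simp: psd_mat_def)

lemma psd_form: "A \<in> psd_mat n \<Longrightarrow> v \<in> carrier_vec n \<Longrightarrow> 0 \<le> (A *\<^sub>v v) \<bullet>c v"
  unfolding psd_mat_def by blast

lemma psd_diag_nonneg:
  assumes "A \<in> psd_mat n" "i < n"
  shows "0 \<le> A $$ (i, i)"
proof -
  have "0 \<le> (A *\<^sub>v unit_vec n i) \<bullet>c unit_vec n i" by (rule psd_form[OF assms(1)]) simp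
  also have "(A *\<^sub>v unit_vec n i) \<bullet>c unit_vec n i = A $$ (i, i)"
  proof -
    have [simp]: "conjugate (unit_vec n i) = (unit_vec n i :: complex vec)"
      by (rule eq_vecI) (auto simp: unit_vec_def)
    have "dim_row A = n" "dim_col A = n" using psd_carrier[OF assms(1)] by auto
    then show ?thesis using assms by simp
  qed
  finally show ?thesis .
qed

text \<open>The quadratic form at e_i + c e_j and the two diagonal entries are real, so the cross
  terms have no imaginary part. The values c = 1 and c = i together then give Hermitian
  symmetry.\<close>

lemma psd_hermitian_aux:
  assumes A: "A \<in> psd_mat n" and ij: "i < n" "j < n" "i \<noteq> j"
  shows "Im (cnj c * A $$ (j, i) + c * A $$ (i, j)) = 0"
proof -
  define v where "v = unit_vec n i + c \<cdot>\<^sub>v unit_vec n j"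
  have v: "v \<in> carrier_vec n" by (simp add: v_def)
  have [simp]: "conjugate v = unit_vec n i + cnj c \<cdot>\<^sub>v unit_vec n j"
    by (rule eq_vecI) (auto simp: v_def unit_vec_def)
  have Av: "A *\<^sub>v v = col A i + c \<cdot>\<^sub>v col A j"
    using ij psd_carrier[OF A] unfolding v_def
    by (subst mult_add_distrib_mat_vec[of _ n n]) (auto simp: mult_mat_vec[of _ n n])
  have "(A *\<^sub>v v) \<bullet>c v = A $$ (i, i) + c * A $$ (i, j) + cnj c * (A $$ (j, i) + c * A $$ (j, j))"
    using ij psd_carrier[OF A] unfolding Av
    by (simp add: scalar_prod_add_distrib[of _ n] add_scalar_prod_distrib[of _ n])
  moreover have "0 \<le> (A *\<^sub>v v) \<bullet>c v" by (rule psd_form[OF A v])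
  moreover have "Im (A $$ (i, i)) = 0" "Im (A $$ (j, j)) = 0"
    using psd_diag_nonneg[OF A] ij by (auto simp: less_eq_complex_def)
  ultimately show ?thesis by (simp add: less_eq_complex_def algebra_simps)
qed

lemma psd_hermitian:
  assumes A: "A \<in> psd_mat n"
  shows "A\<^sup>H = A"
proof (rule eq_matI)
  fix i j assume "i < dim_row A" "j < dim_col A"
  then have ij: "i < n" "j < n" using psd_carrier[OF A] by auto
  show "A\<^sup>H $$ (i, j) = A $$ (i, j)"
  proof (cases "i = j")
    case True
    then show ?thesis using psd_diag_nonneg[OF A] ij psd_carrier[OF A]
      by (auto simp: less_eq_complex_def complex_eq_iff)
  next
    case False
    show ?thesis using psd_hermitian_aux[OF A ij False, of 1] psd_hermitian_aux[OF A ij False, of \<i>]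
        ij psd_carrier[OF A] by (auto simp: complex_eq_iff)
  qed
qed (use psd_carrier[OF A] in auto)

section \<open>Unitary matrices and Schur triangularization\<close>

definition unitary :: "nat \<Rightarrow> complex mat \<Rightarrow> bool" where
  "unitary n U \<longleftrightarrow> U \<in> carrier_mat n n \<and> U\<^sup>H * U = 1\<^sub>m n"

lemma unitary_carrier [simp]: "unitary n U \<Longrightarrow> U \<in> carrier_mat n n"
  by (simp add: unitary_def)

lemma unitary_left: "unitary n U \<Longrightarrow> U\<^sup>H * U = 1\<^sub>m n"
  by (simp add: unitary_def)

lemma unitary_right: "unitary n U \<Longrightarrow> U * U\<^sup>H = 1\<^sub>m n"
  by (rule mat_mult_left_right_inverse[of _ n]) (auto simp: unitary_def)

lemma unitary_cancel:
  assumes "unitary n U" "M \<in> carrier_mat n m"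
  shows "U\<^sup>H * (U * M) = M" "U * (U\<^sup>H * M) = M"
  using assms by (subst assoc_mult_mat[symmetric, of _ n n _ n _ m];
      simp add: unitary_left unitary_right)+

lemma unitary_mult:
  assumes "unitary n U" "unitary n V"
  shows "unitary n (U * V)"
proof -
  have "(U * V)\<^sup>H * (U * V) = V\<^sup>H * (U\<^sup>H * (U * V))"
    using assms by (simp add: adjoint_mult[of _ n n _ n] square_mult_assoc[of _ n])
  also have "\<dots> = 1\<^sub>m n"
    using unitary_cancel(1)[OF assms(1), of V n] unitary_left[OF assms(2)] assms by simp
  finally show ?thesis using assms unfolding unitary_def by auto
qed

lemma four_block_unitary:
  assumes "unitary n U"
  shows "unitary (Suc n) (four_block_mat (1\<^sub>m 1) (0\<^sub>m 1 n) (0\<^sub>m n 1) U)"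
proof -
  let ?F = "four_block_mat (1\<^sub>m 1) (0\<^sub>m 1 n) (0\<^sub>m n 1) U"
  have U: "U \<in> carrier_mat n n" using assms by simp
  have c: "?F \<in> carrier_mat (Suc n) (Suc n)" using U by (auto simp: four_block_carrier_mat)
  have adj: "?F\<^sup>H = four_block_mat (1\<^sub>m 1) (0\<^sub>m 1 n) (0\<^sub>m n 1) (U\<^sup>H)"
    using U by (intro eq_matI) auto
  have "?F\<^sup>H * ?F = four_block_mat (1\<^sub>m 1) (0\<^sub>m 1 n) (0\<^sub>m n 1) (1\<^sub>m n)"
    unfolding adj using U assms
    by (subst mult_four_block_mat[of _ 1 1 _ n _ n _ _ 1 _ n])  (auto simp: unitary_left[OF assms] left_mult_zero_mat[OF U] right_mult_zero_mat[of "U\<^sup>H" n n])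
  also have "\<dots> = 1\<^sub>m (Suc n)" by (rule eq_matI) auto
  finally show ?thesis using c by (simp add: unitary_def)
qed

text \<open>Gram-Schmidt on a basis starting with \<open>v\<close> keeps \<open>v\<close> in front
  but only orthogonalizes. Normalizing the columns produces the scalar \<open>c\<close>.\<close>

lemma unitary_completion:
  fixes v :: "complex vec"
  assumes v: "v \<in> carrier_vec n" and v0: "v \<noteq> 0\<^sub>v n"
  obtains U c where "unitary n U" "c \<noteq> 0" "col U 0 = c \<cdot>\<^sub>v v"
proof -
  have n: "n \<noteq> 0" using v v0 by auto
  interpret cof_vec_space n "TYPE(complex)" .
  define b where "b = basis_completion v"
  define ws where "ws = gram_schmidt n b"
  from basis_completion[OF v v0, folded b_def]
  have dist_b: "distinct b" and indep: "\<not> lin_dep (set b)" and b: "set b \<subseteq> carrier_vec n"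
    and hdb: "hd b = v" and len_b: "length b = n" by auto
  from hdb len_b n obtain vs where bv: "b = v # vs" by (cases b, auto)
  from gram_schmidt_result[OF b dist_b indep refl, folded ws_def]
  have ws: "set ws \<subseteq> carrier_vec n" "corthogonal ws" "length ws = n"
    by (auto simp: len_b)
  from gram_schmidt_hd[OF v, of vs, folded bv] have hdws: "hd ws = v" unfolding ws_def .
  define s where "s w = sqrt (Re (w \<bullet>c w))" for w :: "complex vec"
  have wsi: "ws ! i \<in> carrier_vec n" if "i < n" for i using ws that by (auto intro!: nth_mem)
  \<comment> \<open>\<open>corthogonal\<close> also says that no vector of the list is zero, so
    dividing by the norms is legitimate.\<close>
  have sq: "s (ws ! i) > 0 \<and> complex_of_real (s (ws ! i)) ^ 2 = ws ! i \<bullet>c ws ! i" if "i < n" for i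
  proof -
    have "ws ! i \<bullet>c ws ! i \<noteq> 0" using corthogonalD[OF ws(2), of i i] ws that by auto
    moreover have "ws ! i \<bullet>c ws ! i \<ge> 0" by (rule conjugate_square_ge_0_vec)
    ultimately have "Re (ws ! i \<bullet>c ws ! i) > 0" "Im (ws ! i \<bullet>c ws ! i) = 0"
      by (auto simp: less_eq_complex_def complex_eq_iff)
    then show ?thesis by (auto simp: s_def complex_eq_iff power2_eq_square)
  qed
  define U where "U = mat_of_cols n (map (\<lambda>w. complex_of_real (inverse (s w)) \<cdot>\<^sub>v w) ws)"
  have U: "U \<in> carrier_mat n n" using ws by (auto simp: U_def)
  have colU: "col U i = complex_of_real (inverse (s (ws ! i))) \<cdot>\<^sub>v (ws ! i)" if "i < n" for i
    using that ws wsi unfolding U_def by (subst col_mat_of_cols) auto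
  have "U\<^sup>H * U = 1\<^sub>m n"
  proof (rule eq_matI)
    fix i j assume "i < dim_row (1\<^sub>m n :: complex mat)" "j < dim_col (1\<^sub>m n :: complex mat)"
    then have ij: "i < n" "j < n" by auto
    have "(U\<^sup>H * U) $$ (i, j) = col U j \<bullet>c col U i"
      using U ij by (auto simp: scalar_prod_def mult.commute intro!: sum.cong)
    also have "\<dots> = complex_of_real (inverse (s (ws ! j))) * complex_of_real (inverse (s (ws ! i))) * (ws ! j \<bullet>c ws ! i)"
      using ij wsi[OF ij(1)] wsi[OF ij(2)] by (simp add: colU conjugate_smult_vec)
    also have "\<dots> = 1\<^sub>m n $$ (i, j)"
    proof (cases "i = j")
      case True
      from sq[OF ij(1)] have "complex_of_real (s (ws ! i)) \<noteq> 0"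
        "complex_of_real (s (ws ! i)) ^ 2 = ws ! i \<bullet>c ws ! i" by auto
      with True ij show ?thesis
        by (metis (no_types, lifting) index_one_mat(1) left_inverse mult.assoc mult_1 of_real_inverse power2_eq_square)
    next
      case False
      then have "ws ! j \<bullet>c ws ! i = 0" using corthogonalD[OF ws(2), of j i] ws ij by auto
      with False ij show ?thesis by simp
    qed
    finally show "(U\<^sup>H * U) $$ (i, j) = 1\<^sub>m n $$ (i, j)" .
  qed (use U in auto)
  then have "unitary n U" using U by (simp add: unitary_def)
  moreover have "ws ! 0 = v" using hdws ws n by (metis hd_conv_nth length_0_conv)
  then have "col U 0 = complex_of_real (inverse (s v)) \<cdot>\<^sub>v v" "complex_of_real (inverse (s v)) \<noteq> 0"
    using colU[of 0] sq[of 0] n by auto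
  ultimately show ?thesis using that by blast
qed

text \<open>Deflation: a unitary whose first column is an eigenvector for \<open>e\<close> makes the
  matrix block triangular, and the induction continues on the lower right block. The diagonal
  appears in the order of \<open>es\<close>, so that the eigenvalues can later be listed in
  decreasing order.\<close>

lemma unitary_schur:
  fixes A :: "complex mat"
  assumes "A \<in> carrier_mat n n" "char_poly A = (\<Prod>e\<leftarrow>es. [:- e, 1:])"
  shows "\<exists>U. unitary n U \<and> upper_triangular (U\<^sup>H * A * U) \<and> diag_mat (U\<^sup>H * A * U) = es"
  using assms
proof (induction es arbitrary: n A)
  case Nil
  with degree_monic_char_poly[of A n] have "n = 0" by simp
  with Nil show ?case
    by (intro exI[of _ "1\<^sub>m 0"]) (auto simp: unitary_def diag_mat_def upper_triangular_def)
next
  case (Cons e es n A)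
  note A = Cons.prems(1)
  have cp: "char_poly A = [:- e, 1:] * (\<Prod>e\<leftarrow>es. [:- e, 1:])" using Cons.prems by simp
  then have "eigenvalue A e" by (simp add: eigenvalue_root_char_poly[OF A])
  then obtain v where v: "v \<in> carrier_vec n" "v \<noteq> 0\<^sub>v n" and Av: "A *\<^sub>v v = e \<cdot>\<^sub>v v"
    using A by (auto simp: eigenvalue_def eigenvector_def)
  obtain W c where W: "unitary n W" and c: "c \<noteq> 0" "col W 0 = c \<cdot>\<^sub>v v"
    by (rule unitary_completion[OF v])
  have "n \<noteq> 0" using v by auto
  then obtain m where n: "n = Suc m" by (cases n) auto
  define A' where "A' = W\<^sup>H * A * W"
  have A': "A' \<in> carrier_mat n n" using A W by (simp add: A'_def)
  have sim: "similar_mat A' A" unfolding similar_mat_def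
    by (rule exI[of _ "W\<^sup>H"], rule exI[of _ W], rule similar_mat_witI[of _ _ n])
      (use A W in \<open>auto simp: A'_def unitary_left unitary_right\<close>)
  have cW: "col W 0 \<in> carrier_vec n" using unitary_carrier[OF W] by (simp add: carrier_vecI)
  have "col A' 0 = (W\<^sup>H * A) *\<^sub>v col W 0"
    using A W n unfolding A'_def by (simp add: col_mult2[of _ n n _ n])
  also have "\<dots> = W\<^sup>H *\<^sub>v (A *\<^sub>v col W 0)"
    by (rule assoc_mult_mat_vec[of _ n n _ n]) (use A W cW in auto)
  also have "\<dots> = e \<cdot>\<^sub>v (W\<^sup>H *\<^sub>v col W 0)"
    using A W v by (simp add: c mult_mat_vec[of _ n n] Av smult_smult_assoc mult.commute)
  also have "W\<^sup>H *\<^sub>v col W 0 = col (W\<^sup>H * W) 0"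
    using W n by (simp add: col_mult2[of _ n n _ n])
  also have "\<dots> = unit_vec n 0" using W n by (simp add: unitary_left)
  finally have col0: "col A' 0 = e \<cdot>\<^sub>v unit_vec n 0" .
  have A'i0: "A' $$ (i, 0) = (if i = 0 then e else 0)" if "i < n" for i
    using arg_cong[OF col0, of "\<lambda>v. v $ i"] that A' n by auto
  obtain A1 A2 A0 A3 where split: "split_block A' 1 1 = (A1, A2, A0, A3)"
    by (cases "split_block A' 1 1", auto)
  have "dim_row A' = 1 + m" "dim_col A' = 1 + m" using A' n by auto
  from split_block[OF split this] have A2: "A2 \<in> carrier_mat 1 m"
    and A3: "A3 \<in> carrier_mat m m" and A1: "A1 \<in> carrier_mat 1 1" and A0: "A0 \<in> carrier_mat m 1"
    and A'block: "A' = four_block_mat A1 A2 A0 A3" by auto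
  have A1id: "A1 = mat 1 1 (\<lambda>_. e)"
  proof (rule eq_matI)
    fix i j assume "i < dim_row (mat 1 1 (\<lambda>_. e))" "j < dim_col (mat 1 1 (\<lambda>_. e))"
    then show "A1 $$ (i, j) = mat 1 1 (\<lambda>_. e) $$ (i, j)"
      using A'i0[of 0] n A1 A2 A3 A0 unfolding A'block by auto
  qed (use A1 in auto)
  have A0id: "A0 = 0\<^sub>m m 1"
  proof (rule eq_matI)
    fix i j assume "i < dim_row (0\<^sub>m m 1 :: complex mat)" "j < dim_col (0\<^sub>m m 1 :: complex mat)"
    then show "A0 $$ (i, j) = 0\<^sub>m m 1 $$ (i, j)"
      using A'i0[of "Suc i"] n A1 A2 A3 A0 unfolding A'block by auto
  qed (use A0 in auto)
  \<comment> \<open>The zero block splits the characteristic polynomial. Cancelling the linear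
    factor of \<open>e\<close> leaves exactly the factorization of \<open>char_poly A3\<close> that
    the induction hypothesis asks for.\<close>
  have "char_poly A1 * char_poly A3 = [:- e, 1:] * (\<Prod>e\<leftarrow>es. [:- e, 1:])"
    using char_poly_similar[OF sim] char_poly_four_block_zeros_col[OF A1 A2 A3]
    by (simp add: A'block A0id cp)
  moreover have "char_poly A1 = [:- e, 1:]"
    by (simp add: A1id char_poly_defs det_def sign_def)
  ultimately have "char_poly A3 = (\<Prod>e\<leftarrow>es. [:- e, 1:])"
    by (metis mult_cancel_left pCons_eq_0_iff zero_neq_one)
  from Cons.IH[OF A3 this] obtain V where V: "unitary m V" "upper_triangular (V\<^sup>H * A3 * V)"
    "diag_mat (V\<^sup>H * A3 * V) = es" by auto
  define V' where "V' = four_block_mat (1\<^sub>m 1) (0\<^sub>m 1 m) (0\<^sub>m m 1) V"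
  have V': "unitary n V'" using four_block_unitary[OF V(1)] by (simp add: V'_def n)
  have adj: "V'\<^sup>H = four_block_mat (1\<^sub>m 1) (0\<^sub>m 1 m) (0\<^sub>m m 1) (V\<^sup>H)"
    using unitary_carrier[OF V(1)] unfolding V'_def by (intro eq_matI) auto
  have "V'\<^sup>H * A' * V' = four_block_mat A1 (A2 * V) (0\<^sub>m m 1) (V\<^sup>H * A3 * V)"
    using A1 A2 A3 unitary_carrier[OF V(1)] unfolding adj A'block A0id
    unfolding V'_def
    by (subst mult_four_block_mat[of _ 1 1 _ m _ m _ _ 1 _ m], auto)+
  moreover have "upper_triangular \<dots>"
    by (intro upper_triangular_four_block[of _ 1 _ m]) (use A1 A3 V in \<open>auto simp: A1id\<close>)
  moreover have "diag_mat (four_block_mat A1 (A2 * V) (0\<^sub>m m 1) (V\<^sup>H * A3 * V)) = e # es"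
    using A1 A3 V by (subst diag_four_block_mat[of _ 1 _ m]) (auto simp: A1id diag_mat_def)
  moreover have "(W * V')\<^sup>H * A * (W * V') = V'\<^sup>H * A' * V'"
    using A W V' by (simp add: A'_def adjoint_mult[of _ n n _ n] square_mult_assoc[of _ n])
  ultimately show ?case using unitary_mult[OF W V'] by (intro exI[of _ "W * V'"]) auto
qed

section \<open>Spectral theorem and functional calculus\<close>

text \<open>Packages a diagonalization in the shape quantified over in \<open>mat_fun\<close>. No
  order is imposed on \<open>d\<close>, since a functional calculus may destroy it.\<close>

definition spectral :: "nat \<Rightarrow> complex mat \<Rightarrow> complex mat \<Rightarrow> (nat \<Rightarrow> real) \<Rightarrow> bool" where
  "spectral n A U d \<longleftrightarrow> unitary n U \<and> A = U * rdiag n d * U\<^sup>H"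

definition decreasing_nonneg :: "nat \<Rightarrow> (nat \<Rightarrow> real) \<Rightarrow> bool" where
  "decreasing_nonneg n d \<longleftrightarrow> (\<forall>i j. i \<le> j \<longrightarrow> j < n \<longrightarrow> d j \<le> d i \<and> 0 \<le> d j)"

lemma decreasing_nonnegD:
  "decreasing_nonneg n d \<Longrightarrow> i \<le> j \<Longrightarrow> j < n \<Longrightarrow> d j \<le> d i"
  "decreasing_nonneg n d \<Longrightarrow> j < n \<Longrightarrow> 0 \<le> d j"
  by (auto simp: decreasing_nonneg_def)

lemma spectral_carrier: "spectral n A U d \<Longrightarrow> A \<in> carrier_mat n n"
  by (auto simp: spectral_def)

lemma spectral_unitary: "spectral n A U d \<Longrightarrow> unitary n U"
  by (simp add: spectral_def)

text \<open>Hermitian symmetry reflects the zeros below the diagonal to the entries above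
  it.\<close>

lemma psd_upper_triangular:
  assumes "T \<in> psd_mat n" "upper_triangular T"
  shows "T = rdiag n (\<lambda>i. Re (T $$ (i, i)))"
proof (rule eq_matI)
  have T: "T \<in> carrier_mat n n" using assms by simp
  fix i j assume "i < dim_row (rdiag n (\<lambda>i. Re (T $$ (i, i))))" "j < dim_col (rdiag n (\<lambda>i. Re (T $$ (i, i))))"
  then have ij: "i < n" "j < n" by (auto simp: mat_diag_def)
  consider "i = j" | "j < i" | "i < j" by linarith
  then show "T $$ (i, j) = rdiag n (\<lambda>i. Re (T $$ (i, i))) $$ (i, j)"
  proof cases
    case 1
    then show ?thesis using psd_diag_nonneg[OF assms(1) ij(1)] ij
      by (auto simp: mat_diag_def less_eq_complex_def complex_eq_iff)
  next
    case 2
    then show ?thesis using upper_triangularD[OF assms(2)] ij T by (auto simp: mat_diag_def)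
  next
    case 3
    then have "T $$ (j, i) = 0" using upper_triangularD[OF assms(2)] ij T by auto
    moreover have "T $$ (i, j) = cnj (T $$ (j, i))"
      using arg_cong[OF psd_hermitian[OF assms(1)], of "\<lambda>M. M $$ (i, j)"] ij T by simp
    ultimately show ?thesis using 3 ij by (simp add: mat_diag_def)
  qed
qed (use psd_carrier[OF assms(1)] in \<open>auto simp: mat_diag_def\<close>)

lemma psd_spectral:
  assumes A: "A \<in> psd_mat n"
  obtains U d where "spectral n A U d" "decreasing_nonneg n d"
proof -
  obtain as where as: "char_poly A = (\<Prod>a\<leftarrow>as. [:- a, 1:])" "length as = n"
    using char_poly_factorized[OF psd_carrier[OF A]] by auto
  \<comment> \<open>The sort key is the real part because the eigenvalues are only known to be
    complex numbers here; they turn out real once \<open>T\<close> is seen to be diagonal and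
    positive semidefinite.\<close>
  define es where "es = rev (sort_key Re as)"
  have "mset es = mset as" by (simp add: es_def)
  then have "char_poly A = (\<Prod>a\<leftarrow>es. [:- a, 1:])" and len: "length es = n"
    using as by (metis mset_map prod_mset_prod_list, metis size_mset)
  from unitary_schur[OF psd_carrier[OF A] this(1)] obtain U where U: "unitary n U"
    "upper_triangular (U\<^sup>H * A * U)" "diag_mat (U\<^sup>H * A * U) = es" by auto
  define T where "T = U\<^sup>H * A * U"
  define d where "d i = Re (T $$ (i, i))" for i
  have T: "T \<in> psd_mat n" using psd_congruence[OF A unitary_carrier[OF U(1)]] by (simp add: T_def)
  have Td: "T = rdiag n d"
    using psd_upper_triangular[OF T] U by (simp add: T_def d_def)
  have es: "es ! i = T $$ (i, i)" if "i < n" for i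
    using arg_cong[OF U(3), of "\<lambda>l. l ! i"] that psd_carrier[OF T] unitary_carrier[OF U(1)]
    by (auto simp: diag_mat_def T_def)
  have "A = U * T * U\<^sup>H"
  proof -
    have "U * T * U\<^sup>H = U * (U\<^sup>H * (A * (U * U\<^sup>H)))"
      using A U by (simp add: T_def square_mult_assoc[of _ n])
    also have "\<dots> = A * (U * U\<^sup>H)" by (rule unitary_cancel(2)[OF U(1), of _ n]) (use A U in auto)
    also have "\<dots> = A" using psd_carrier[OF A] by (simp add: unitary_right[OF U(1)])
    finally show ?thesis ..
  qed
  then have "spectral n A U d" using U by (simp add: spectral_def Td)
  moreover have "decreasing_nonneg n d" unfolding decreasing_nonneg_def
  proof (intro allI impI)
    fix i j :: nat assume ij: "i \<le> j" "j < n"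
    have "sorted (map Re (rev es))" by (simp add: es_def)
    then have "sorted (rev (map Re es))" by (simp add: rev_map)
    then have "Re (es ! j) \<le> Re (es ! i)"
      using ij len sorted_rev_nth_mono[of "map Re es" i j] by simp
    then show "d j \<le> d i \<and> 0 \<le> d j"
      using ij es psd_diag_nonneg[OF T ij(2)] by (auto simp: d_def less_eq_complex_def)
  qed
  ultimately show ?thesis using that by blast
qed

text \<open>Independence of the diagonalization: for two of them, with unitaries \<open>U\<close>
  and \<open>V\<close>, the matrix \<open>W = V\<^sup>H * U\<close> intertwines the diagonals. Where
  \<open>W $$ (i, j)\<close> is nonzero, \<open>d j\<close> equals \<open>e i\<close>, hence so do
  their images under \<open>f\<close>, and \<open>W\<close> also intertwines the transformed
  diagonals.\<close>

lemma mat_fun_spectral: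
  assumes "spectral n A U d"
  shows "mat_fun f A = U * rdiag n (\<lambda>i. f (d i)) * U\<^sup>H"
proof -
  have A: "A \<in> carrier_mat n n" and U: "unitary n U" and AU: "A = U * rdiag n d * U\<^sup>H"
    using assms by (auto simp: spectral_def)
  have n: "dim_row A = n" using A by auto
  have Uc: "U \<in> carrier_mat n n" using U by simp
  show ?thesis unfolding mat_fun_def n
  proof (rule the_equality)
    show "\<exists>V e. V \<in> carrier_mat n n \<and> V\<^sup>H * V = 1\<^sub>m n \<and> A = V * rdiag n e * V\<^sup>H \<and>
      U * rdiag n (\<lambda>i. f (d i)) * U\<^sup>H = V * rdiag n (\<lambda>i. f (e i)) * V\<^sup>H"
      using U AU by (auto simp: unitary_def)
  next
    fix C
    assume "\<exists>V e. V \<in> carrier_mat n n \<and> V\<^sup>H * V = 1\<^sub>m n \<and> A = V * rdiag n e * V\<^sup>H \<and>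
      C = V * rdiag n (\<lambda>i. f (e i)) * V\<^sup>H"
    then obtain V e where V: "unitary n V" and AV: "A = V * rdiag n e * V\<^sup>H"
      and C: "C = V * rdiag n (\<lambda>i. f (e i)) * V\<^sup>H" by (auto simp: unitary_def)
    have Vc: "V \<in> carrier_mat n n" using V by simp
    define W where "W = V\<^sup>H * U"
    have W: "W \<in> carrier_mat n n" using Uc Vc by (simp add: W_def)
    have inter: "W * rdiag n g = rdiag n h * W" if "U * rdiag n g * U\<^sup>H = V * rdiag n h * V\<^sup>H" for g h
    proof -
      have "W * rdiag n g = V\<^sup>H * (U * (rdiag n g * (U\<^sup>H * U)))"
        using Uc Vc right_mult_one_mat[of "rdiag n g" n n]
        by (simp add: W_def unitary_left[OF U] square_mult_assoc[of _ n])
      also have "\<dots> = V\<^sup>H * (U * rdiag n g * U\<^sup>H) * U"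
        using Uc Vc by (simp add: square_mult_assoc[of _ n])
      also have "\<dots> = V\<^sup>H * (V * (rdiag n h * (V\<^sup>H * U)))"
        using Uc Vc unfolding that by (simp add: square_mult_assoc[of _ n])
      also have "\<dots> = rdiag n h * W"
        unfolding W_def by (rule unitary_cancel(1)[OF V, of _ n]) (use Uc Vc in auto)
      finally show ?thesis .
    qed
    have entry: "W $$ (i, j) * complex_of_real (d j) = complex_of_real (e i) * W $$ (i, j)"
      if "i < n" "j < n" for i j
      using arg_cong[OF inter[of d e], of "\<lambda>M. M $$ (i, j)"] that W AU AV
      by (simp add: mat_diag_mult_left[of _ n n] mat_diag_mult_right[of _ n n])
    have WW: "W * rdiag n (\<lambda>i. f (d i)) = rdiag n (\<lambda>i. f (e i)) * W"
    proof (rule eq_matI)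
      fix i j assume "i < dim_row (rdiag n (\<lambda>i. f (e i)) * W)" "j < dim_col (rdiag n (\<lambda>i. f (e i)) * W)"
      then have ij: "i < n" "j < n" using W by (auto simp: mat_diag_def)
      show "(W * rdiag n (\<lambda>i. f (d i))) $$ (i, j) = (rdiag n (\<lambda>i. f (e i)) * W) $$ (i, j)"
        using entry[OF ij] ij W
        by (cases "W $$ (i, j) = 0") (auto simp: mat_diag_mult_left[of _ n n] mat_diag_mult_right[of _ n n])
    qed (use W in \<open>auto simp: mat_diag_def\<close>)
    have "C = V * (rdiag n (\<lambda>i. f (e i)) * (V\<^sup>H * (U * U\<^sup>H)))"
      using Uc Vc by (simp add: C unitary_right[OF U] square_mult_assoc[of _ n])
    also have "\<dots> = V * (rdiag n (\<lambda>i. f (e i)) * W) * U\<^sup>H"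
      using Uc Vc by (simp add: W_def square_mult_assoc[of _ n])
    also have "\<dots> = V * (V\<^sup>H * (U * (rdiag n (\<lambda>i. f (d i)) * U\<^sup>H)))"
      using Uc Vc unfolding WW[symmetric] by (simp add: W_def square_mult_assoc[of _ n])
    also have "\<dots> = U * (rdiag n (\<lambda>i. f (d i)) * U\<^sup>H)"
      by (rule unitary_cancel(2)[OF V, of _ n]) (use Uc Vc in auto)
    finally show "C = U * rdiag n (\<lambda>i. f (d i)) * U\<^sup>H"
      using Uc by (simp add: square_mult_assoc[of _ n])
  qed
qed

lemma spectral_mat_fun: "spectral n A U d \<Longrightarrow> spectral n (mat_fun f A) U (\<lambda>i. f (d i))"
  by (simp add: mat_fun_spectral spectral_def)

lemma spectral_mult:
  assumes "spectral n A U d" "spectral n B U e"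
  shows "spectral n (A * B) U (\<lambda>i. d i * e i)"
proof -
  have U: "unitary n U" "U \<in> carrier_mat n n" using assms by (auto simp: spectral_def)
  have "A * B = U * (rdiag n d * (U\<^sup>H * (U * (rdiag n e * U\<^sup>H))))"
    using assms U by (simp add: spectral_def square_mult_assoc[of _ n])
  also have "\<dots> = U * (rdiag n d * (rdiag n e * U\<^sup>H))"
    using U by (subst unitary_cancel(1)[OF U(1), of _ n]) auto
  also have "\<dots> = U * (rdiag n d * rdiag n e) * U\<^sup>H"
    using U by (simp add: square_mult_assoc[of _ n] del: mat_diag_diag)
  finally show ?thesis using U by (simp add: spectral_def)
qed

text \<open>Taking square roots of the eigenvalues exhibits \<open>A\<close> as a Gram
  matrix.\<close>

lemma spectral_psd:
  assumes "spectral n A U d" "\<And>i. i < n \<Longrightarrow> 0 \<le> d i"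
  shows "A \<in> psd_mat n"
proof -
  have U: "unitary n U" "U \<in> carrier_mat n n" using assms by (auto simp: spectral_def)
  define S where "S = rdiag n (\<lambda>i. sqrt (d i))"
  have "S * S = rdiag n d"
    using assms(2) unfolding S_def mat_diag_diag
    by (intro eq_matI) (auto simp: mat_diag_def simp flip: of_real_mult)
  then have "A = U * (S * S) * U\<^sup>H" using assms by (simp add: spectral_def)
  also have "\<dots> = (S * U\<^sup>H)\<^sup>H * (S * U\<^sup>H)"
    using U by (simp add: S_def adjoint_mult[of _ n n _ n] square_mult_assoc[of _ n] del: mat_diag_diag)
  finally show ?thesis using psd_gram[of "S * U\<^sup>H" n n] U by (simp add: S_def)
qed

lemma spectral_det:
  assumes "spectral n A U d"
  shows "det A = complex_of_real (\<Prod>i<n. d i)"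
proof -
  have U: "unitary n U" "U \<in> carrier_mat n n" using assms by (auto simp: spectral_def)
  have 1: "det U * det (U\<^sup>H) = 1"
    using det_mult[of U n "U\<^sup>H"] U by (simp add: unitary_right)
  have "det A = det U * det (rdiag n d) * det (U\<^sup>H)"
    using assms U by (simp add: spectral_def det_mult[of _ n])
  also have "\<dots> = det (rdiag n d)" using 1 by (simp add: mult.commute mult.left_commute)
  also have "\<dots> = (\<Prod>i<n. complex_of_real (d i))"
    by (subst det_upper_triangular[of _ n])
       (auto simp: mat_diag_def upper_triangular_def diag_mat_def prod.list_conv_set_nth atLeast0LessThan)
  finally show ?thesis by simp
qed

text \<open>Bridge from the sorted root multiset in \<open>eigvals_desc\<close> to an ordered
  diagonalization; through it, eigenvalue products become products of values of
  \<open>d\<close>.\<close>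

lemma spectral_eigvals:
  assumes "spectral n A U d" "decreasing_nonneg n d"
  shows "eigvals_desc A = map d [0..<n]"
proof -
  have U: "unitary n U" "U \<in> carrier_mat n n" and A: "A = U * rdiag n d * U\<^sup>H"
    using assms by (auto simp: spectral_def)
  have "similar_mat A (rdiag n d)" unfolding similar_mat_def
    by (rule exI[of _ U], rule exI[of _ "U\<^sup>H"], rule similar_mat_witI[of _ _ n])
      (use U in \<open>auto simp: A unitary_left unitary_right\<close>)
  then have "char_poly A = char_poly (rdiag n d)" by (rule char_poly_similar)
  also have "\<dots> = (\<Prod>a\<leftarrow>diag_mat (rdiag n d). [:- a, 1:])"
    by (rule char_poly_upper_triangular[of _ n]) (auto simp: mat_diag_def)
  also have "diag_mat (rdiag n d) = map (\<lambda>i. complex_of_real (d i)) [0..<n]"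
    by (auto simp: diag_mat_def mat_diag_def)
  finally have cp: "char_poly A = (\<Prod>a\<leftarrow>map (\<lambda>i. complex_of_real (d i)) [0..<n]. [:- a, 1:])" .
  have pr: "proots (\<Prod>a\<leftarrow>xs. [:- a, 1:]) = mset xs" for xs :: "complex list"
  proof (induction xs)
    case (Cons a xs)
    have "proots ([:- a, 1:] * (\<Prod>a\<leftarrow>xs. [:- a, 1:])) = proots [:- a, 1:] + proots (\<Prod>a\<leftarrow>xs. [:- a, 1:])"
      by (rule proots_mult) (auto simp: prod_list_zero_iff)
    then show ?case using Cons by simp
  qed simp
  have "image_mset Re (proots (char_poly A)) = mset (map d [0..<n])"
    unfolding cp pr by (simp only: mset_map[symmetric] map_map comp_def Re_complex_of_real)
  then have "eigvals_desc A = rev (sort (map d [0..<n]))"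
    by (simp add: eigvals_desc_def sorted_list_of_multiset_mset del: mset_map)
  also have "sort (map d [0..<n]) = rev (map d [0..<n])"
    by (rule properties_for_sort) (auto simp: sorted_rev_iff_nth_mono decreasing_nonnegD(1)[OF assms(2)])
  finally show ?thesis by simp
qed

text \<open>The quantity that \<open>log_majorized\<close> compares. For positive semidefinite
  \<open>A\<close> it is the largest eigenvalue of the \<open>k\<close>-th exterior power of
  \<open>A\<close>.\<close>

definition eigprod :: "nat \<Rightarrow> complex mat \<Rightarrow> real" where
  "eigprod k A = (\<Prod>i=1..k. eigval A i)"

lemma spectral_eigprod:
  assumes "spectral n A U d" "decreasing_nonneg n d" "k \<le> n"
  shows "eigprod k A = (\<Prod>i<k. d i)"
proof -
  \<comment> \<open>\<open>eigval\<close> counts from 1 and \<open>d\<close> from 0. The case split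
    on \<open>k\<close> treats the empty product apart, where \<open>k - 1\<close> would be
    misleading.\<close>
  have "eigprod k A = (\<Prod>i<k. eigval A (Suc i))"
    unfolding eigprod_def using prod.atLeast_Suc_atMost_Suc_shift[of "eigval A" 0 "k - 1"]
    by (cases k) (auto simp: lessThan_Suc_atMost atMost_atLeast0)
  also have "\<dots> = (\<Prod>i<k. d i)"
    using assms by (intro prod.cong) (auto simp: eigval_def spectral_eigvals)
  finally show ?thesis .
qed

section \<open>The Cauchy-Binet bound for compressions\<close>

text \<open>The largest of \<open>k + 1\<close> distinct indices is at least \<open>k\<close>, so
  its value is at most \<open>d k\<close>; remove it and use induction.\<close>

lemma prod_subset_le_initial:
  assumes d: "decreasing_nonneg n d" and "S \<subseteq> {..<n}" "card S = k"
  shows "(\<Prod>i\<in>S. d i) \<le> (\<Prod>i<k. d i)"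
  using assms(2,3)
proof (induction k arbitrary: S)
  case 0
  then have "S = {}" using finite_subset[of S "{..<n}"] by auto
  then show ?case by simp
next
  case (Suc k)
  have fin: "finite S" using Suc.prems(1) by (rule finite_subset) simp
  have ne: "S \<noteq> {}" using Suc.prems by auto
  define m where "m = Max S"
  have m: "m \<in> S" using fin ne by (simp add: m_def)
  have "S \<subseteq> {..m}" using fin by (auto simp: m_def)
  then have "Suc k \<le> Suc m" using card_mono[of "{..m}" S] Suc.prems by simp
  then have km: "k \<le> m" "m < n" using m Suc.prems by auto
  have "(\<Prod>i\<in>S. d i) = (\<Prod>i\<in>S - {m}. d i) * d m"
    using fin m by (subst prod.remove[of _ m]) (auto simp: mult.commute)
  also have "\<dots> \<le> (\<Prod>i<k. d i) * d k"
  proof (rule mult_mono)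
    show "(\<Prod>i\<in>S - {m}. d i) \<le> (\<Prod>i<k. d i)"
      by (rule Suc.IH) (use Suc.prems m in auto)
    show "0 \<le> (\<Prod>i<k. d i)" using km decreasing_nonnegD(2)[OF d] by (intro prod_nonneg) auto
  qed (use km decreasing_nonnegD[OF d] in auto)
  finally show ?case by simp
qed

definition row_select :: "nat \<Rightarrow> complex mat \<Rightarrow> (nat \<Rightarrow> nat) \<Rightarrow> complex mat" where
  "row_select k W f = mat k k (\<lambda>(i, j). W $$ (f i, j))"

text \<open>Arbitrary maps from the first \<open>k\<close> indices to the first \<open>n\<close>,
  repetitions included. Fixing them to the identity elsewhere makes the set finite and matches the
  index set in \<open>det_linear_rows_sum\<close>.\<close>

definition selections :: "nat \<Rightarrow> nat \<Rightarrow> (nat \<Rightarrow> nat) set" where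
  "selections k n = {f. (\<forall>i\<in>{0..<k}. f i \<in> {0..<n}) \<and> (\<forall>i. i \<notin> {0..<k} \<longrightarrow> f i = i)}"

lemma row_select_carrier [simp]: "row_select k W f \<in> carrier_mat k k"
  by (simp add: row_select_def)

lemma det_row_select_not_inj:
  assumes "\<not> inj_on f {0..<k}"
  shows "det (row_select k W f) = 0"
proof -
  obtain i j where ij: "i < k" "j < k" "i \<noteq> j" "f i = f j" using assms by (auto simp: inj_on_def)
  show ?thesis
    by (rule det_identical_rows[OF row_select_carrier ij(3,1,2)]) (use ij in \<open>auto simp: row_select_def\<close>)
qed

text \<open>Each row of the product is a linear combination of rows of \<open>W\<close>; expand the
  determinant multilinearly in the rows.\<close>

lemma det_gram_selections:
  assumes W: "W \<in> carrier_mat n k"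
  shows "det (W\<^sup>H * rdiag n d * W) =
    (\<Sum>f\<in>selections k n. (\<Prod>i\<in>{0..<k}. cnj (W $$ (f i, i)) * d (f i)) * det (row_select k W f))"
proof -
  define A where "A = W\<^sup>H * rdiag n d"
  have A: "A \<in> carrier_mat k n" unfolding A_def using W by (intro mult_carrier_mat[of _ k n]) auto
  have Aij: "A $$ (i, l) = cnj (W $$ (l, i)) * d l" if "i < k" "l < n" for i l
    using W that by (simp add: A_def mat_diag_mult_right[of _ k n])
  have "det (A * W) = (\<Sum>f\<in>selections k n. det (mat\<^sub>r k k (\<lambda>i. A $$ (i, f i) \<cdot>\<^sub>v row W (f i))))"
    unfolding mat_mul_finsum_alt[OF A W] selections_def
    by (rule det_linear_rows_sum) (use W in auto)
  also have "\<dots> = (\<Sum>f\<in>selections k n. (\<Prod>i\<in>{0..<k}. cnj (W $$ (f i, i)) * d (f i)) * det (row_select k W f))"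
  proof (rule sum.cong[OF refl])
    fix f assume f: "f \<in> selections k n"
    have "det (mat\<^sub>r k k (\<lambda>i. A $$ (i, f i) \<cdot>\<^sub>v row W (f i))) =
      (\<Prod>i\<in>{0..<k}. A $$ (i, f i)) * det (mat\<^sub>r k k (\<lambda>i. row W (f i)))"
      by (rule det_rows_mul) (use W f in auto)
    also have "mat\<^sub>r k k (\<lambda>i. row W (f i)) = row_select k W f"
      using W f by (intro eq_matI) (auto simp: row_select_def selections_def)
    also have "(\<Prod>i\<in>{0..<k}. A $$ (i, f i)) = (\<Prod>i\<in>{0..<k}. cnj (W $$ (f i, i)) * d (f i))"
      using f by (intro prod.cong) (auto simp: Aij selections_def)
    finally show "det (mat\<^sub>r k k (\<lambda>i. A $$ (i, f i) \<cdot>\<^sub>v row W (f i))) =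
      (\<Prod>i\<in>{0..<k}. cnj (W $$ (f i, i)) * d (f i)) * det (row_select k W f)" .
  qed
  finally show ?thesis by (simp add: A_def)
qed

text \<open>Lets a sum over selections be reindexed by a permutation, for the averaging argument
  below.\<close>

lemma selections_compose_bij:
  assumes p: "p permutes {0..<k}"
  shows "bij_betw (\<lambda>f. f \<circ> p) (selections k n) (selections k n)"
proof (rule bij_betwI[of _ _ _ "\<lambda>f. f \<circ> Hilbert_Choice.inv p"])
  have maps: "f \<circ> q \<in> selections k n" if "f \<in> selections k n" "q permutes {0..<k}" for f q
    using that permutes_in_image[OF that(2)] permutes_not_in[OF that(2)]
    by (auto simp: selections_def)
  show "(\<lambda>f. f \<circ> p) \<in> selections k n \<rightarrow> selections k n" using maps p by auto
  show "(\<lambda>f. f \<circ> Hilbert_Choice.inv p) \<in> selections k n \<rightarrow> selections k n" using maps permutes_inv[OF p] by auto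
qed (auto simp: permutes_inv_o[OF p] comp_assoc)

text \<open>Cauchy-Binet, summed over all row selections instead of increasing ones.\<close>

lemma det_gram_cauchy_binet:
  assumes W: "W \<in> carrier_mat n k"
  shows "fact k * det (W\<^sup>H * rdiag n d * W) =
    complex_of_real (\<Sum>f\<in>selections k n. (\<Prod>i\<in>{0..<k}. d (f i)) * (cmod (det (row_select k W f)))\<^sup>2)"
proof -
  let ?F = "selections k n" and ?P = "{p. p permutes {0..<k}}"
  let ?w = "\<lambda>f. (\<Prod>i\<in>{0..<k}. cnj (W $$ (f i, i)) * d (f i)) * det (row_select k W f)"
  \<comment> \<open>Reindexing by \<open>p\<close> leaves the product of the \<open>d (f i)\<close>
    unchanged and multiplies the minor by the sign of \<open>p\<close>. Only the conjugated factors
    still depend on \<open>p\<close> otherwise.\<close>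
  have perm: "det (W\<^sup>H * rdiag n d * W) = (\<Sum>f\<in>?F. (\<Prod>i\<in>{0..<k}. complex_of_real (d (f i))) * det (row_select k W f) *
      (signof p * (\<Prod>i\<in>{0..<k}. cnj (W $$ (f (p i), i)))))" if p: "p permutes {0..<k}" for p
  proof -
    have "det (W\<^sup>H * rdiag n d * W) = (\<Sum>f\<in>?F. ?w (f \<circ> p))"
      unfolding det_gram_selections[OF W]
      using sum.reindex_bij_betw[OF selections_compose_bij[OF p], of ?w n] by simp
    also have "\<dots> = (\<Sum>f\<in>?F. (\<Prod>i\<in>{0..<k}. complex_of_real (d (f i))) * det (row_select k W f) *
      (signof p * (\<Prod>i\<in>{0..<k}. cnj (W $$ (f (p i), i)))))"
    proof (rule sum.cong[OF refl])
      fix f assume "f \<in> ?F"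
      have "row_select k W (f \<circ> p) = mat k k (\<lambda>(i, j). row_select k W f $$ (p i, j))"
        using permutes_in_image[OF p] by (intro eq_matI) (auto simp: row_select_def)
      then have "det (row_select k W (f \<circ> p)) = signof p * det (row_select k W f)"
        using det_permute_rows[OF row_select_carrier p, of W f] by simp
      moreover have "(\<Prod>i\<in>{0..<k}. complex_of_real (d (f (p i)))) = (\<Prod>i\<in>{0..<k}. complex_of_real (d (f i)))"
        using prod.permute[OF p, of "\<lambda>i. complex_of_real (d (f i))"] by (simp add: comp_def)
      ultimately show "?w (f \<circ> p) = (\<Prod>i\<in>{0..<k}. complex_of_real (d (f i))) * det (row_select k W f) *
        (signof p * (\<Prod>i\<in>{0..<k}. cnj (W $$ (f (p i), i))))"
        by (simp add: prod.distrib)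
    qed
    finally show ?thesis .
  qed
  \<comment> \<open>Summing what depends on \<open>p\<close> gives the Leibniz expansion of the
    conjugate minor. Summing over all permutations is what produces the factor
    \<open>fact k\<close>.\<close>
  have cdet: "(\<Sum>p\<in>?P. signof p * (\<Prod>i\<in>{0..<k}. cnj (W $$ (f (p i), i)))) = cnj (det (row_select k W f))" for f
  proof -
    have "det (row_select k W f) = det (transpose_mat (row_select k W f))"
      by (simp add: det_transpose[OF row_select_carrier])
    also have "\<dots> = (\<Sum>p\<in>?P. signof p * (\<Prod>i\<in>{0..<k}. transpose_mat (row_select k W f) $$ (i, p i)))"
      by (rule det_def'[of _ k]) simp
    also have "\<dots> = (\<Sum>p\<in>?P. signof p * (\<Prod>i\<in>{0..<k}. W $$ (f (p i), i)))"
      by (intro sum.cong prod.cong arg_cong2[of _ _ _ _ "(*)"] refl)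
         (auto simp: row_select_def permutes_in_image)
    finally show ?thesis by simp
  qed
  have "fact k * det (W\<^sup>H * rdiag n d * W) = (\<Sum>p\<in>?P. det (W\<^sup>H * rdiag n d * W))"
    by (simp add: card_permutations)
  also have "\<dots> = (\<Sum>p\<in>?P. \<Sum>f\<in>?F. (\<Prod>i\<in>{0..<k}. complex_of_real (d (f i))) * det (row_select k W f) *
      (signof p * (\<Prod>i\<in>{0..<k}. cnj (W $$ (f (p i), i)))))"
    by (rule sum.cong) (auto simp: perm)
  also have "\<dots> = (\<Sum>f\<in>?F. (\<Prod>i\<in>{0..<k}. complex_of_real (d (f i))) * det (row_select k W f) * cnj (det (row_select k W f)))"
    by (subst sum.swap) (simp add: sum_distrib_left[symmetric] cdet)
  also have "\<dots> = complex_of_real (\<Sum>f\<in>?F. (\<Prod>i\<in>{0..<k}. d (f i)) * (cmod (det (row_select k W f)))\<^sup>2)"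
    by (simp add: complex_norm_square[symmetric] mult.assoc)
  finally show ?thesis .
qed

text \<open>In the Cauchy-Binet sum a selection with a repeated row contributes zero, and an
  injective one carries \<open>k\<close> distinct values of \<open>d\<close>, hence at most the
  product of the first \<open>k\<close>.\<close>

lemma det_compression_diag_le:
  assumes W: "W \<in> carrier_mat n k" and d: "decreasing_nonneg n d"
  shows "Re (det (W\<^sup>H * rdiag n d * W)) \<le> (\<Prod>i<k. d i) * Re (det (W\<^sup>H * W))"
proof -
  let ?F = "selections k n"
  have fin: "finite ?F" unfolding selections_def by (rule finite_bounded_functions) auto
  have Re_fact: "fact k * Re z = x" if "fact k * z = complex_of_real x" for z x
  proof -
    have "complex_of_real (fact k) * z = complex_of_real x" using that by simp
    then have "Re (complex_of_real (fact k) * z) = x" by (simp only: Re_complex_of_real)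
    then show ?thesis by (simp del: of_real_fact)
  qed
  \<comment> \<open>The constant diagonal 1 turns the same formula into one for the Gram
    determinant.\<close>
  have 1: "fact k * Re (det (W\<^sup>H * W)) = (\<Sum>f\<in>?F. (cmod (det (row_select k W f)))\<^sup>2)"
    using Re_fact[OF det_gram_cauchy_binet[OF W, of "\<lambda>_. 1"]] W by simp
  have "fact k * Re (det (W\<^sup>H * rdiag n d * W)) =
      (\<Sum>f\<in>?F. (\<Prod>i\<in>{0..<k}. d (f i)) * (cmod (det (row_select k W f)))\<^sup>2)"
    by (rule Re_fact[OF det_gram_cauchy_binet[OF W]])
  also have "\<dots> \<le> (\<Sum>f\<in>?F. (\<Prod>i<k. d i) * (cmod (det (row_select k W f)))\<^sup>2)"
  proof (rule sum_mono)
    fix f assume f: "f \<in> ?F"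
    show "(\<Prod>i\<in>{0..<k}. d (f i)) * (cmod (det (row_select k W f)))\<^sup>2 \<le> (\<Prod>i<k. d i) * (cmod (det (row_select k W f)))\<^sup>2"
    proof (cases "inj_on f {0..<k}")
      case True
      have "(\<Prod>i\<in>{0..<k}. d (f i)) = (\<Prod>i\<in>f ` {0..<k}. d i)" using True by (simp add: prod.reindex)
      also have "\<dots> \<le> (\<Prod>i<k. d i)"
        by (rule prod_subset_le_initial[OF d]) (use True f in \<open>auto simp: card_image selections_def\<close>)
      finally show ?thesis by (rule mult_right_mono) simp
    next
      case False
      then show ?thesis by (simp add: det_row_select_not_inj)
    qed
  qed
  also have "\<dots> = fact k * ((\<Prod>i<k. d i) * Re (det (W\<^sup>H * W)))"
    by (simp add: sum_distrib_left[symmetric] 1[symmetric])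
  finally show ?thesis by simp
qed

text \<open>One half of a variational characterization of \<open>eigprod\<close>; diagonalizing
  \<open>P\<close> reduces it to the diagonal case with \<open>W\<close> replaced by
  \<open>U\<^sup>H * W\<close>.\<close>

lemma det_compression_le:
  assumes P: "P \<in> psd_mat n" and W: "W \<in> carrier_mat n k" and k: "k \<le> n"
  shows "Re (det (W\<^sup>H * P * W)) \<le> eigprod k P * Re (det (W\<^sup>H * W))"
proof -
  obtain U d where sp: "spectral n P U d" and d: "decreasing_nonneg n d" by (rule psd_spectral[OF P])
  have U: "unitary n U" "U \<in> carrier_mat n n" and PU: "P = U * rdiag n d * U\<^sup>H"
    using sp by (auto simp: spectral_def)
  define V where "V = U\<^sup>H * W"
  have V: "V \<in> carrier_mat n k" unfolding V_def using U W by (intro mult_carrier_mat[of _ n n]) auto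
  have VH: "V\<^sup>H = W\<^sup>H * U" unfolding V_def using U W by (subst adjoint_mult[of _ n n _ k]) auto
  have Wc: "W\<^sup>H \<in> carrier_mat k n" using W by simp
  have "W\<^sup>H * P * W = W\<^sup>H * (U * (rdiag n d * (U\<^sup>H * W)))"
    unfolding PU using U W Wc
    by (simp add: assoc_mult_mat[of _ k n _ n _ k] assoc_mult_mat[of _ n n _ n _ k] assoc_mult_mat[of _ n n _ n _ n] mult_carrier_mat[of _ n n])
  also have "\<dots> = V\<^sup>H * rdiag n d * V"
    unfolding VH unfolding V_def using U W Wc
    by (simp add: assoc_mult_mat[of _ k n _ n _ k] assoc_mult_mat[of _ n n _ n _ k] assoc_mult_mat[of _ k n _ n _ n] mult_carrier_mat[of _ n n] mult_carrier_mat[of _ k n])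
  finally have 1: "W\<^sup>H * P * W = V\<^sup>H * rdiag n d * V" .
  have "V\<^sup>H * V = W\<^sup>H * (U * (U\<^sup>H * W))"
    unfolding VH unfolding V_def using U W Wc
    by (simp add: assoc_mult_mat[of _ k n _ n _ k] mult_carrier_mat[of _ n n])
  also have "U * (U\<^sup>H * W) = W" by (rule unitary_cancel(2)[OF U(1) W])
  finally show ?thesis
    using det_compression_diag_le[OF V d] by (simp add: 1 spectral_eigprod[OF sp d k])
qed

text \<open>The other half: equality is reached when the columns of \<open>W\<close> are
  eigenvectors for the \<open>k\<close> largest eigenvalues.\<close>

lemma det_compression_attained:
  assumes P: "P \<in> psd_mat n" and k: "k \<le> n"
  obtains W where "W \<in> carrier_mat n k" "W\<^sup>H * W = 1\<^sub>m k" "det (W\<^sup>H * P * W) = complex_of_real (eigprod k P)"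
proof -
  obtain U d where sp: "spectral n P U d" and d: "decreasing_nonneg n d" by (rule psd_spectral[OF P])
  have U: "unitary n U" "U \<in> carrier_mat n n" and PU: "P = U * rdiag n d * U\<^sup>H"
    using sp by (auto simp: spectral_def)
  \<comment> \<open>Multiplication by \<open>E\<close> on the right keeps the first \<open>k\<close>
    columns.\<close>
  define E :: "complex mat" where "E = mat n k (\<lambda>(i, j). if i = j then 1 else 0)"
  have E: "E \<in> carrier_mat n k" by (simp add: E_def)
  have EDE: "E\<^sup>H * (rdiag n g * E) = rdiag k g" for g
  proof (rule eq_matI)
    fix i j assume "i < dim_row (rdiag k g)" "j < dim_col (rdiag k g)"
    then have ij: "i < k" "j < k" by (auto simp: mat_diag_def)
    have "(E\<^sup>H * (rdiag n g * E)) $$ (i, j) =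
        (\<Sum>l<n. cnj (if l = i then 1 else 0) * (complex_of_real (g l) * (if l = j then 1 else 0)))"
      using ij k E by (simp add: E_def mat_diag_mult_left[of _ n k] scalar_prod_def atLeast0LessThan)
    also have "\<dots> = (\<Sum>l<n. if l = i then (if i = j then complex_of_real (g i) else 0) else 0)"
      by (intro sum.cong) auto
    also have "\<dots> = rdiag k g $$ (i, j)" using ij k by (auto simp: mat_diag_def)
    finally show "(E\<^sup>H * (rdiag n g * E)) $$ (i, j) = rdiag k g $$ (i, j)" .
  qed (auto simp: mat_diag_def E_def)
  define W where "W = U * E"
  have W: "W \<in> carrier_mat n k" unfolding W_def using U E by (intro mult_carrier_mat[of _ n n]) auto
  have WH: "W\<^sup>H = E\<^sup>H * U\<^sup>H" unfolding W_def by (rule adjoint_mult[OF U(2) E])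
  have Ec: "E\<^sup>H \<in> carrier_mat k n" using E by simp
  have cancel: "W\<^sup>H * (U * M) = E\<^sup>H * M" if M: "M \<in> carrier_mat n k" for M
  proof -
    have "W\<^sup>H * (U * M) = E\<^sup>H * (U\<^sup>H * (U * M))"
      unfolding WH using U Ec M by (intro assoc_mult_mat[of _ k n _ n _ k]) auto
    then show ?thesis by (simp add: unitary_cancel(1)[OF U(1) M])
  qed
  have "W\<^sup>H * W = E\<^sup>H * E" using cancel[OF E] by (simp add: W_def)
  also have "\<dots> = 1\<^sub>m k" using EDE[of "\<lambda>_. 1"] E by simp
  finally have WW: "W\<^sup>H * W = 1\<^sub>m k" .
  have "P * W = U * (rdiag n d * (U\<^sup>H * (U * E)))"
    unfolding PU W_def using U E
    by (simp add: assoc_mult_mat[of _ n n _ n _ k] assoc_mult_mat[of _ n n _ n _ n] mult_carrier_mat[of _ n n])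
  then have "P * W = U * (rdiag n d * E)" by (simp add: unitary_cancel(1)[OF U(1) E])
  moreover have "W\<^sup>H * P * W = W\<^sup>H * (P * W)"
    using W P by (intro assoc_mult_mat[of _ k n _ n _ k]) auto
  ultimately have "W\<^sup>H * P * W = rdiag k d"
    using cancel[of "rdiag n d * E"] E EDE by (auto simp: mult_carrier_mat[of _ n n])
  moreover have "spectral k (rdiag k d) (1\<^sub>m k) d"
    using left_mult_one_mat[of "rdiag k d" k k] right_mult_one_mat[of "rdiag k d" k k]
    by (simp add: spectral_def unitary_def)
  ultimately have "det (W\<^sup>H * P * W) = complex_of_real (eigprod k P)"
    by (simp add: spectral_det spectral_eigprod[OF sp d k])
  with W WW show ?thesis using that by blast
qed

text \<open>Choose an isometry \<open>V\<close> attaining the left side. Compressing the Gram matrix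
  of \<open>M\<close> by \<open>N * V\<close> splits off its factor and leaves the compression of
  the Gram matrix of \<open>N\<close> by \<open>V\<close>.\<close>

lemma eigprod_gram_mult_le:
  assumes M: "M \<in> carrier_mat n n" and N: "N \<in> carrier_mat n n" and k: "k \<le> n"
  shows "eigprod k ((M * N)\<^sup>H * (M * N)) \<le> eigprod k (M\<^sup>H * M) * eigprod k (N\<^sup>H * N)"
proof -
  have psd: "(M * N)\<^sup>H * (M * N) \<in> psd_mat n" "M\<^sup>H * M \<in> psd_mat n" "N\<^sup>H * N \<in> psd_mat n"
    using M N by (auto intro!: psd_gram)
  obtain V where V: "V \<in> carrier_mat n k" and VV: "V\<^sup>H * V = 1\<^sub>m k"
    and det: "det (V\<^sup>H * ((M * N)\<^sup>H * (M * N)) * V) = complex_of_real (eigprod k ((M * N)\<^sup>H * (M * N)))"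
    by (rule det_compression_attained[OF psd(1) k])
  have NV: "N * V \<in> carrier_mat n k" and NVH: "(N * V)\<^sup>H = V\<^sup>H * N\<^sup>H" and VH: "V\<^sup>H \<in> carrier_mat k n"
    using N V adjoint_mult[OF N V] by auto
  have 1: "V\<^sup>H * ((M * N)\<^sup>H * (M * N)) * V = (N * V)\<^sup>H * (M\<^sup>H * M) * (N * V)"
    unfolding NVH adjoint_mult[OF M N] using M N V VH
    by (simp add: assoc_mult_mat[of _ k n _ n _ k] assoc_mult_mat[of _ n n _ n _ k] assoc_mult_mat[of _ n n _ n _ n]
        assoc_mult_mat[of _ k n _ n _ n] mult_carrier_mat[of _ n n] mult_carrier_mat[of _ k n])
  have 2: "(N * V)\<^sup>H * (N * V) = V\<^sup>H * (N\<^sup>H * N) * V"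
    unfolding NVH using N V VH
    by (simp add: assoc_mult_mat[of _ k n _ n _ k] assoc_mult_mat[of _ n n _ n _ k] mult_carrier_mat[of _ n n] mult_carrier_mat[of _ k n])
  have nn: "0 \<le> eigprod k (M\<^sup>H * M)"
  proof -
    obtain U d where sp: "spectral n (M\<^sup>H * M) U d" and d: "decreasing_nonneg n d" by (rule psd_spectral[OF psd(2)])
    show ?thesis unfolding spectral_eigprod[OF sp d k] using k decreasing_nonnegD(2)[OF d] by (intro prod_nonneg) auto
  qed
  have "eigprod k ((M * N)\<^sup>H * (M * N)) = Re (det ((N * V)\<^sup>H * (M\<^sup>H * M) * (N * V)))"
    using det by (simp add: 1)
  also have "\<dots> \<le> eigprod k (M\<^sup>H * M) * Re (det ((N * V)\<^sup>H * (N * V)))"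
    by (rule det_compression_le[OF psd(2) NV k])
  also have "\<dots> \<le> eigprod k (M\<^sup>H * M) * eigprod k (N\<^sup>H * N)"
    using det_compression_le[OF psd(3) V k] VV nn by (intro mult_left_mono) (auto simp: 2)
  finally show ?thesis .
qed

section \<open>Norms of exterior powers\<close>

text \<open>The operator norm of the \<open>k\<close>-th exterior power of \<open>M\<close>, i.e. the product of the \<open>k\<close>
  largest singular values.\<close>

definition ext_norm :: "nat \<Rightarrow> complex mat \<Rightarrow> real" where
  "ext_norm k M = sqrt (eigprod k (M\<^sup>H * M))"

lemma eigprod_nonneg:
  assumes "P \<in> psd_mat n" "k \<le> n"
  shows "0 \<le> eigprod k P"
proof -
  obtain U d where sp: "spectral n P U d" and d: "decreasing_nonneg n d" by (rule psd_spectral[OF assms(1)])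
  show ?thesis unfolding spectral_eigprod[OF sp d assms(2)]
    using assms(2) decreasing_nonnegD(2)[OF d] by (intro prod_nonneg) auto
qed

lemma ext_norm_sq:
  assumes "M \<in> carrier_mat n n" "k \<le> n"
  shows "(ext_norm k M)\<^sup>2 = eigprod k (M\<^sup>H * M)"
  using eigprod_nonneg[OF psd_gram[OF assms(1)] assms(2)] by (simp add: ext_norm_def)

lemma ext_norm_nonneg [simp]:
  assumes "M \<in> carrier_mat n n" "k \<le> n"
  shows "0 \<le> ext_norm k M"
  using eigprod_nonneg[OF psd_gram[OF assms(1)] assms(2)] by (simp add: ext_norm_def)

lemma ext_norm_mult:
  assumes "M \<in> carrier_mat n n" "N \<in> carrier_mat n n" "k \<le> n"
  shows "ext_norm k (M * N) \<le> ext_norm k M * ext_norm k N"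
  using eigprod_gram_mult_le[OF assms] by (simp add: ext_norm_def flip: real_sqrt_mult)

lemma decreasing_nonneg_power: "decreasing_nonneg n d \<Longrightarrow> decreasing_nonneg n (\<lambda>i. d i ^ m)"
  by (auto simp: decreasing_nonneg_def intro!: power_mono)

lemma ext_norm_psd:
  assumes P: "P \<in> psd_mat n" and k: "k \<le> n"
  shows "ext_norm k P = eigprod k P"
proof -
  obtain U d where sp: "spectral n P U d" and d: "decreasing_nonneg n d" by (rule psd_spectral[OF P])
  have "spectral n (P * P) U (\<lambda>i. d i ^ 2)"
    using spectral_mult[OF sp sp] by (simp add: power2_eq_square)
  then have "eigprod k (P * P) = (eigprod k P)\<^sup>2"
    using spectral_eigprod[OF _ decreasing_nonneg_power[OF d] k] spectral_eigprod[OF sp d k]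
    by (simp add: prod_power_distrib)
  then show ?thesis using eigprod_nonneg[OF P k] by (simp add: ext_norm_def psd_hermitian[OF P])
qed

lemma ext_norm_gram:
  assumes "M \<in> carrier_mat n n" "k \<le> n"
  shows "ext_norm k (M\<^sup>H * M) = (ext_norm k M)\<^sup>2"
  using ext_norm_psd[OF psd_gram[OF assms(1)] assms(2)] ext_norm_sq[OF assms] by simp

text \<open>The square of the norm of N is the norm of its Gram matrix, hence at most the product of
  the norms of the adjoint and of N. Dividing gives one inequality, and exchanging N with its
  adjoint the other.\<close>

lemma ext_norm_adjoint:
  assumes M: "M \<in> carrier_mat n n" and k: "k \<le> n"
  shows "ext_norm k (M\<^sup>H) = ext_norm k M"
proof -
  have le: "ext_norm k N \<le> ext_norm k (N\<^sup>H)" if N: "N \<in> carrier_mat n n" for N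
  proof (cases "ext_norm k N = 0")
    case True
    then show ?thesis using ext_norm_nonneg[of "N\<^sup>H" n k] N k by simp
  next
    case False
    then have "0 < ext_norm k N" using ext_norm_nonneg[OF N k] by simp
    moreover have "ext_norm k N * ext_norm k N \<le> ext_norm k (N\<^sup>H) * ext_norm k N"
      using ext_norm_mult[of "N\<^sup>H" n N k] ext_norm_gram[OF N k] N k by (simp add: power2_eq_square)
    ultimately show ?thesis by simp
  qed
  from le[OF M] le[of "M\<^sup>H"] M show ?thesis by simp
qed

lemma ext_norm_one [simp]: "k \<le> n \<Longrightarrow> ext_norm k (1\<^sub>m n) = 1"
proof -
  assume k: "k \<le> n"
  have "spectral n (1\<^sub>m n) (1\<^sub>m n) (\<lambda>_. 1)" by (simp add: spectral_def unitary_def)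
  then have "eigprod k (1\<^sub>m n) = 1"
    using k by (subst spectral_eigprod[of n]) (auto simp: decreasing_nonneg_def)
  then show ?thesis by (simp add: ext_norm_def)
qed

lemma ext_norm_power_le:
  assumes "M \<in> carrier_mat n n" "k \<le> n"
  shows "ext_norm k (M ^\<^sub>m j) \<le> ext_norm k M ^ j"
proof (induction j)
  case (Suc j)
  have "ext_norm k (M ^\<^sub>m Suc j) \<le> ext_norm k (M ^\<^sub>m j) * ext_norm k M"
    using assms by (simp add: ext_norm_mult[of _ n])
  also have "\<dots> \<le> ext_norm k M ^ j * ext_norm k M"
    using Suc assms by (intro mult_right_mono) auto
  finally show ?case by (simp add: mult.commute)
qed (use assms in simp)

lemma spectral_power: "spectral n A U d \<Longrightarrow> spectral n (A ^\<^sub>m j) U (\<lambda>i. d i ^ j)"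
proof (induction j)
  case 0
  then have "unitary n U" "dim_row A = n" using spectral_carrier[OF 0] spectral_unitary[OF 0] by auto
  then show ?case using unitary_right[of n U] right_mult_one_mat[of U n n] by (simp add: spectral_def)
next
  case (Suc j)
  from spectral_mult[OF Suc.IH[OF Suc.prems] Suc.prems] show ?case by (simp add: mult.commute)
qed

lemma ext_norm_psd_power:
  assumes P: "P \<in> psd_mat n" and k: "k \<le> n"
  shows "ext_norm k (P ^\<^sub>m j) = ext_norm k P ^ j"
proof -
  obtain U d where sp: "spectral n P U d" and d: "decreasing_nonneg n d" by (rule psd_spectral[OF P])
  have "P ^\<^sub>m j \<in> psd_mat n"
    using spectral_psd[OF spectral_power[OF sp]] decreasing_nonnegD(2)[OF d] by simp
  then show ?thesis
    using spectral_eigprod[OF spectral_power[OF sp] decreasing_nonneg_power[OF d] k] spectral_eigprod[OF sp d k]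
    by (simp add: ext_norm_psd[OF _ k] P prod_power_distrib)
qed

text \<open>A spectral radius bound by the power trick: the constants contributed by \<open>S\<close> and \<open>S'\<close>
  disappear after taking \<open>j\<close>-th roots.\<close>

lemma ext_norm_psd_le_of_factorization:
  assumes P: "P \<in> psd_mat n" and carr: "S \<in> carrier_mat n n" "S' \<in> carrier_mat n n" "M \<in> carrier_mat n n"
    and k: "k \<le> n" and factor: "P = S * M * S'" and cancel: "M * (S' * S) = M"
  shows "ext_norm k P \<le> ext_norm k M"
proof (rule ccontr)
  assume "\<not> ?thesis"
  then have gt: "ext_norm k M < ext_norm k P" by simp
  define C where "C = ext_norm k S * ext_norm k S'"
  have nn: "0 \<le> ext_norm k S" "0 \<le> ext_norm k S'" "0 \<le> ext_norm k M" using carr k by auto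
  \<comment> \<open>Between consecutive factors of the power, \<open>S' * S\<close> is absorbed by
    \<open>cancel\<close>, so a single \<open>S\<close> and a single \<open>S'\<close> survive for
    every exponent.\<close>
  have pow: "P ^\<^sub>m Suc j = S * (M ^\<^sub>m Suc j * S')" for j
  proof (induction j)
    case 0
    then show ?case using P carr by (simp add: factor square_mult_assoc[of _ n])
  next
    case (Suc j)
    have "P ^\<^sub>m Suc (Suc j) = S * (M ^\<^sub>m Suc j * S') * (S * M * S')"
      using Suc by (simp add: factor)
    also have "\<dots> = S * (M ^\<^sub>m j * (M * (S' * S)) * (M * S'))"
      using carr by (simp add: square_mult_assoc[of _ n])
    also have "\<dots> = S * (M ^\<^sub>m Suc (Suc j) * S')"
      unfolding cancel using carr by (simp add: square_mult_assoc[of _ n])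
    finally show ?case .
  qed
  have bound: "ext_norm k P ^ Suc j \<le> C * ext_norm k M ^ Suc j" for j
  proof -
    have "ext_norm k P ^ Suc j = ext_norm k (S * (M ^\<^sub>m Suc j * S'))"
      using ext_norm_psd_power[OF P k, of "Suc j"] pow[of j] by simp
    also have "\<dots> \<le> ext_norm k S * ext_norm k (M ^\<^sub>m Suc j * S')"
      using carr k by (intro ext_norm_mult) auto
    also have "\<dots> \<le> ext_norm k S * (ext_norm k (M ^\<^sub>m Suc j) * ext_norm k S')"
      using carr k nn by (intro mult_left_mono ext_norm_mult) auto
    also have "\<dots> \<le> ext_norm k S * (ext_norm k M ^ Suc j * ext_norm k S')"
      using carr k nn by (intro mult_left_mono mult_right_mono ext_norm_power_le) auto
    finally show ?thesis by (simp add: C_def mult_ac)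
  qed
  show False
  proof (cases "ext_norm k M = 0")
    case True
    then show False using bound[of 0] gt by simp
  next
    case False
    then have pos: "0 < ext_norm k M" using nn by simp
    \<comment> \<open>A ratio above 1 has unbounded powers, but \<open>bound\<close> keeps them all
      below \<open>C\<close>.\<close>
    define r where "r = ext_norm k P / ext_norm k M"
    have r: "1 < r" using gt pos by (simp add: r_def)
    obtain j where "C < r ^ j" using real_arch_pow[OF r] by blast
    also have "r ^ j \<le> r ^ Suc j" using r by (intro power_increasing) auto
    also have "\<dots> \<le> C"
      unfolding r_def power_divide using bound[of j] pos by (simp only: pos_divide_le_eq zero_less_power)
    finally show False by simp
  qed
qed

section \<open>Real powers\<close>

text \<open>One formula for both signs of \<open>r\<close>: a zero eigenvalue stays zero either way,
  since \<open>inverse 0\<close> and \<open>0 powr r\<close> are both 0.\<close>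

lemma psd_powr_eq:
  assumes "A \<in> psd_mat n"
  shows "A ^\<^sub>M r = mat_fun (\<lambda>x. x powr r) A"
proof -
  obtain U d where sp: "spectral n A U d" and d: "decreasing_nonneg n d" by (rule psd_spectral[OF assms])
  have eq: "U * rdiag n (\<lambda>i. inverse (d i) powr - r) * U\<^sup>H = U * rdiag n (\<lambda>i. d i powr r) * U\<^sup>H"
    using decreasing_nonnegD(2)[OF d]
    by (intro arg_cong2[of _ _ _ _ "(*)"] refl eq_matI) (auto simp: mat_diag_def powr_minus inverse_powr)
  show ?thesis
    using mat_fun_spectral[OF spectral_mat_fun[OF sp, of inverse], of "\<lambda>x. x powr - r"]
      mat_fun_spectral[OF sp, of "\<lambda>x. x powr r"] eq
    unfolding mat_powr_def gen_inv_def by argo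
qed

lemma spectral_powr:
  assumes "spectral n A U d" "decreasing_nonneg n d"
  shows "spectral n (A ^\<^sub>M r) U (\<lambda>i. d i powr r)"
proof -
  have "A \<in> psd_mat n" using spectral_psd[OF assms(1)] decreasing_nonnegD(2)[OF assms(2)] by simp
  then show ?thesis using spectral_mat_fun[OF assms(1)] by (simp add: psd_powr_eq)
qed

lemma psd_powr [simp]: "A \<in> psd_mat n \<Longrightarrow> A ^\<^sub>M r \<in> psd_mat n"
  by (metis psd_spectral spectral_powr spectral_psd powr_ge_zero)

lemma powr_carrier [simp]: "A \<in> psd_mat n \<Longrightarrow> A ^\<^sub>M r \<in> carrier_mat n n"
  by (rule psd_carrier) simp

lemma powr_adjoint [simp]: "A \<in> psd_mat n \<Longrightarrow> (A ^\<^sub>M r)\<^sup>H = A ^\<^sub>M r"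
  by (rule psd_hermitian[of _ n]) simp

lemma spectral_unique: "spectral n A U d \<Longrightarrow> spectral n B U e \<Longrightarrow> (\<And>i. i < n \<Longrightarrow> d i = e i) \<Longrightarrow> A = B"
  unfolding spectral_def
  by (auto intro!: arg_cong2[of _ _ _ _ "(*)"] eq_matI simp: mat_diag_def)

text \<open>Valid for all real exponents, even of opposite sign, because \<open>powr_add\<close>
  also holds at base 0. In particular A^r times A^(-r) is the support projection A^0.\<close>

lemma powr_add_mat:
  assumes "A \<in> psd_mat n"
  shows "A ^\<^sub>M r * A ^\<^sub>M s = A ^\<^sub>M (r + s)"
proof -
  obtain U d where sp: "spectral n A U d" and d: "decreasing_nonneg n d" by (rule psd_spectral[OF assms])
  show ?thesis
    by (rule spectral_unique[OF spectral_mult[OF spectral_powr[OF sp d] spectral_powr[OF sp d]] spectral_powr[OF sp d]])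
      (simp add: powr_add)
qed

lemma powr_add_mat_assoc:
  assumes "A \<in> psd_mat n" "M \<in> carrier_mat n n"
  shows "A ^\<^sub>M r * (A ^\<^sub>M s * M) = A ^\<^sub>M (r + s) * M"
  using assms by (simp add: powr_add_mat[of A n, symmetric] square_mult_assoc[of _ n])

lemma powr_powr_mat:
  assumes "A \<in> psd_mat n"
  shows "(A ^\<^sub>M r) ^\<^sub>M s = A ^\<^sub>M (r * s)"
proof -
  obtain U d where sp: "spectral n A U d" and d: "decreasing_nonneg n d" by (rule psd_spectral[OF assms])
  \<comment> \<open>For negative \<open>r\<close> the eigenvalues of A^r need not be decreasing, so
    the general functional calculus replaces \<open>spectral_powr\<close>.\<close>
  have "spectral n ((A ^\<^sub>M r) ^\<^sub>M s) U (\<lambda>i. (d i powr r) powr s)"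
    unfolding psd_powr_eq[OF psd_powr[OF assms]] by (rule spectral_mat_fun[OF spectral_powr[OF sp d]])
  from spectral_unique[OF this spectral_powr[OF sp d]] show ?thesis by (simp add: powr_powr)
qed

lemma powr_one_mat [simp]:
  assumes "A \<in> psd_mat n"
  shows "A ^\<^sub>M 1 = A"
proof -
  obtain U d where sp: "spectral n A U d" and d: "decreasing_nonneg n d" by (rule psd_spectral[OF assms])
  from spectral_unique[OF spectral_powr[OF sp d] sp] decreasing_nonnegD(2)[OF d] show ?thesis by simp
qed

lemma ext_norm_powr:
  assumes P: "P \<in> psd_mat n" and k: "k \<le> n" and r: "0 < r"
  shows "ext_norm k (P ^\<^sub>M r) = ext_norm k P powr r"
proof -
  obtain U d where sp: "spectral n P U d" and d: "decreasing_nonneg n d" by (rule psd_spectral[OF P])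
  \<comment> \<open>A positive exponent preserves the order, so the first \<open>k\<close>
    eigenvalues remain the largest.\<close>
  have dr: "decreasing_nonneg n (\<lambda>i. d i powr r)"
    using d r by (auto simp: decreasing_nonneg_def intro!: powr_mono2)
  have "eigprod k (P ^\<^sub>M r) = (\<Prod>i<k. d i powr r)" by (rule spectral_eigprod[OF spectral_powr[OF sp d] dr k])
  also have "\<dots> = (\<Prod>i<k. d i) powr r"
    using k decreasing_nonnegD(2)[OF d] by (subst prod_powr_distrib) auto
  finally show ?thesis using P by (simp add: ext_norm_psd[OF _ k] spectral_eigprod[OF sp d k])
qed

lemma det_powr:
  assumes P: "P \<in> psd_mat n"
  shows "det (P ^\<^sub>M r) = complex_of_real (Re (det P) powr r)"
proof -
  obtain U d where sp: "spectral n P U d" and d: "decreasing_nonneg n d" by (rule psd_spectral[OF P])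
  have "(\<Prod>i<n. d i powr r) = (\<Prod>i<n. d i) powr r"
    using decreasing_nonnegD(2)[OF d] by (subst prod_powr_distrib) auto
  then show ?thesis by (simp add: spectral_det[OF spectral_powr[OF sp d]] spectral_det[OF sp] flip: of_real_prod)
qed

lemma eigprod_full:
  assumes "P \<in> psd_mat n"
  shows "det P = complex_of_real (eigprod n P)"
  using psd_spectral[OF assms] by (metis order_refl spectral_det spectral_eigprod)

text \<open>Idempotence of the support projection makes its norm a solution of x = x^2.\<close>

lemma ext_norm_powr_zero_le_one:
  assumes P: "P \<in> psd_mat n" and k: "k \<le> n"
  shows "ext_norm k (P ^\<^sub>M 0) \<le> 1"
proof -
  let ?x = "ext_norm k (P ^\<^sub>M 0)"
  have "?x = ?x * ?x"
    using ext_norm_gram[of "P ^\<^sub>M 0" n k] powr_add_mat[OF P, of 0 0] P k by (simp add: power2_eq_square)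
  then show ?thesis by (metis mult_cancel_right1 order_refl zero_le_one)
qed

section \<open>Interpolation\<close>

text \<open>Continuity is not required: the supremum \<open>M\<close> of \<open>\<phi>\<close>, normalized by its bound,
  satisfies \<open>M\<^sup>2 \<le> M\<close> because every point is the midpoint of an endpoint and another point.\<close>

lemma midpoint_log_convex_bound_pos:
  fixes \<phi> :: "real \<Rightarrow> real"
  assumes nonneg: "\<And>t. t \<in> {0..1} \<Longrightarrow> 0 \<le> \<phi> t" and bdd: "\<And>t. t \<in> {0..1} \<Longrightarrow> \<phi> t \<le> B"
    and mid: "\<And>s u. s \<in> {0..1} \<Longrightarrow> u \<in> {0..1} \<Longrightarrow> (\<phi> ((s + u) / 2))\<^sup>2 \<le> \<phi> s * \<phi> u"
    and a: "\<phi> 0 \<le> a" "0 < a" and b: "\<phi> 1 \<le> b" "0 < b" and t: "t \<in> {0..1}"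
  shows "\<phi> t \<le> a powr (1 - t) * b powr t"
proof -
  \<comment> \<open>The geometric interpolation of the endpoint bounds is log-affine, so dividing by
    it preserves midpoint log-convexity and normalizes both bounds to 1.\<close>
  define g where "g t = a powr (1 - t) * b powr t" for t
  have gpos: "0 < g t" for t using a b by (simp add: g_def)
  have gmid: "(g ((s + u) / 2))\<^sup>2 = g s * g u" for s u
  proof -
    have "g x = exp ((1 - x) * ln a + x * ln b)" for x using a b by (simp add: g_def powr_def exp_add)
    then show ?thesis by (simp add: power2_eq_square exp_add[symmetric]) (simp add: field_simps)
  qed
  define F where "F t = \<phi> t / g t" for t
  have Fmid: "(F ((s + u) / 2))\<^sup>2 \<le> F s * F u" if "s \<in> {0..1}" "u \<in> {0..1}" for s u
    using mid[OF that] gpos[of s] gpos[of u]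
    by (simp add: F_def power_divide gmid divide_right_mono)
  have Fnn: "0 \<le> F t" if "t \<in> {0..1}" for t using nonneg[OF that] gpos[of t] by (simp add: F_def)
  \<comment> \<open>A positive minimum of \<open>g\<close> keeps the quotient \<open>F\<close>
    bounded, so that its supremum exists.\<close>
  have "compact (g ` {0..1})"
    unfolding g_def using a b by (intro compact_continuous_image continuous_intros) auto
  then obtain x where x: "x \<in> {0..1}" "\<And>y. y \<in> {0..1} \<Longrightarrow> g x \<le> g y"
    using compact_attains_inf[of "g ` {0..1}"] by auto
  have "0 \<le> B" using nonneg[of 0] bdd[of 0] by simp
  then have Fbdd: "F y \<le> B / g x" if "y \<in> {0..1}" for y
    unfolding F_def using bdd[OF that] x(2)[OF that] gpos[of x] nonneg[OF that] by (intro frac_le) auto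
  define M where "M = Sup (F ` {0..1})"
  have le_M: "F y \<le> M" if "y \<in> {0..1}" for y
    unfolding M_def using that Fbdd by (intro cSup_upper bdd_aboveI[of _ "B / g x"]) auto
  have F01: "F 0 \<le> 1" "F 1 \<le> 1" using a b by (auto simp: F_def g_def)
  have sq: "(F y)\<^sup>2 \<le> M" if y: "y \<in> {0..1}" for y
  proof (cases "y \<le> 1 / 2")
    case True
    have "(F y)\<^sup>2 \<le> F 0 * F (2 * y)" using Fmid[of 0 "2 * y"] y True by simp
    also have "\<dots> \<le> 1 * F (2 * y)" using F01 Fnn[of "2 * y"] y True by (intro mult_right_mono) auto
    also have "\<dots> \<le> M" using le_M[of "2 * y"] y True by simp
    finally show ?thesis .
  next
    case False
    have "(F y)\<^sup>2 \<le> F 1 * F (2 * y - 1)" using Fmid[of 1 "2 * y - 1"] y False by simp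
    also have "\<dots> \<le> 1 * F (2 * y - 1)" using F01 Fnn[of "2 * y - 1"] y False by (intro mult_right_mono) auto
    also have "\<dots> \<le> M" using le_M[of "2 * y - 1"] y False by simp
    finally show ?thesis .
  qed
  have Mnn: "0 \<le> M" using le_M[of 0] Fnn[of 0] by simp
  have "M \<le> sqrt M" unfolding M_def
  proof (rule cSup_least)
    fix z assume "z \<in> F ` {0..1}"
    then obtain y where y: "y \<in> {0..1}" "z = F y" by auto
    then show "z \<le> sqrt (Sup (F ` {0..1}))" using sq[OF y(1)] by (simp add: M_def real_le_rsqrt)
  qed simp
  then have "M * M \<le> M" using Mnn by (metis mult_mono real_sqrt_ge_zero real_sqrt_mult_self abs_of_nonneg)
  then have "M \<le> 1" using mult_strict_left_mono[of 1 M M] by fastforce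
  then have "F t \<le> 1" using le_M[OF t] by simp
  then show ?thesis using gpos[of t] by (simp add: F_def g_def)
qed

text \<open>Admits vanishing endpoint bounds: enlarge both by a positive null sequence and pass to
  the limit. For \<open>t\<close> strictly between 0 and 1 both exponents are positive, so the
  powers converge even at base 0.\<close>

lemma midpoint_log_convex_bound:
  fixes \<phi> :: "real \<Rightarrow> real"
  assumes nonneg: "\<And>t. t \<in> {0..1} \<Longrightarrow> 0 \<le> \<phi> t" and bdd: "\<And>t. t \<in> {0..1} \<Longrightarrow> \<phi> t \<le> B"
    and mid: "\<And>s u. s \<in> {0..1} \<Longrightarrow> u \<in> {0..1} \<Longrightarrow> (\<phi> ((s + u) / 2))\<^sup>2 \<le> \<phi> s * \<phi> u"
    and a: "\<phi> 0 \<le> a" and b: "\<phi> 1 \<le> b" and t: "0 < t" "t < 1"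
  shows "\<phi> t \<le> a powr (1 - t) * b powr t"
proof -
  have ab: "0 \<le> a" "0 \<le> b" using nonneg[of 0] nonneg[of 1] a b by auto
  have e: "(\<lambda>m. inverse (real (Suc m))) \<longlonglongrightarrow> 0" by (rule LIMSEQ_inverse_real_of_nat)
  have "(\<lambda>m. (a + inverse (real (Suc m))) powr (1 - t) * (b + inverse (real (Suc m))) powr t) \<longlonglongrightarrow>
      (a + 0) powr (1 - t) * (b + 0) powr t"
    using ab t by (intro tendsto_mult tendsto_powr' tendsto_add tendsto_const e) auto
  moreover have "\<phi> t \<le> (a + inverse (real (Suc m))) powr (1 - t) * (b + inverse (real (Suc m))) powr t" for m
  proof (rule midpoint_log_convex_bound_pos[where B = B])
    have "0 < inverse (real (Suc m))" by simp
    then show "\<phi> 0 \<le> a + inverse (real (Suc m))" "0 < a + inverse (real (Suc m))"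
      "\<phi> 1 \<le> b + inverse (real (Suc m))" "0 < b + inverse (real (Suc m))"
      using a b ab by linarith+
  qed (use assms in auto)
  ultimately show ?thesis
    using LIMSEQ_le_const[of _ "(a + 0) powr (1 - t) * (b + 0) powr t" "\<phi> t"] by auto
qed

text \<open>With \<open>m\<close> the midpoint, the square of the left norm is the norm of X^m K
  Y^(s+u) K' X^m, where K' is the adjoint of K. Moving powers of \<open>X\<close> cyclically turns
  the outer exponents into \<open>s\<close> and \<open>u\<close>;
  \<open>ext_norm_psd_le_of_factorization\<close> shows that this cannot lower the norm.\<close>

lemma ext_norm_sandwich_midpoint:
  assumes X: "X \<in> psd_mat n" and Y: "Y \<in> psd_mat n" and K: "K \<in> carrier_mat n n" and k: "k \<le> n"
  defines "f \<equiv> \<lambda>s. ext_norm k (X ^\<^sub>M s * K * Y ^\<^sub>M s)"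
  shows "(f ((s + u) / 2))\<^sup>2 \<le> f s * f u"
proof -
  define m where "m = (s + u) / 2"
  define Q where "Q = X ^\<^sub>M m * K * Y ^\<^sub>M m"
  define M where "M = (X ^\<^sub>M s * K * Y ^\<^sub>M s) * (X ^\<^sub>M u * K * Y ^\<^sub>M u)\<^sup>H"
  have Q: "Q \<in> carrier_mat n n" using X Y K by (simp add: Q_def)
  have M: "M \<in> carrier_mat n n" using X Y K by (simp add: M_def)
  have adj: "(X ^\<^sub>M r * K * Y ^\<^sub>M r)\<^sup>H = Y ^\<^sub>M r * (K\<^sup>H * X ^\<^sub>M r)" for r
    using X Y K by (simp add: adjoint_mult[of _ n n _ n])
  have mm: "m + m = s + u" by (simp add: m_def)
  have QQ: "Q * Q\<^sup>H = X ^\<^sub>M (m - s) * M * X ^\<^sub>M (m - u)"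
    unfolding Q_def M_def adj using X Y K
    by (simp add: square_mult_assoc[of _ n] powr_add_mat[of _ n] powr_add_mat_assoc[of _ n] mm)
  \<comment> \<open>The exponents m - u and m - s are opposite, so the inserted product is a support
    projection of \<open>X\<close>, absorbed by the last factor of \<open>M\<close>.\<close>
  have "m + (m - s) = u" by (simp add: m_def field_simps)
  then have cancel: "M * (X ^\<^sub>M (m - u) * X ^\<^sub>M (m - s)) = M"
    unfolding M_def adj using X Y K
    by (simp add: square_mult_assoc[of _ n] powr_add_mat[of _ n] powr_add_mat_assoc[of _ n])
  have psd: "Q * Q\<^sup>H \<in> psd_mat n" using psd_gram[of "Q\<^sup>H" n n] Q by simp
  have "(f m)\<^sup>2 = ext_norm k (Q * Q\<^sup>H)"
    using ext_norm_gram[of "Q\<^sup>H" n k] ext_norm_adjoint[OF Q k] Q k by (simp add: f_def Q_def)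
  also have "\<dots> \<le> ext_norm k M"
    by (rule ext_norm_psd_le_of_factorization[OF psd _ _ M k QQ cancel]) (use X in auto)
  also have "\<dots> \<le> f s * f u"
    unfolding M_def f_def using X Y K k
    by (subst ext_norm_adjoint[of "X ^\<^sub>M u * K * Y ^\<^sub>M u" n, symmetric]) (auto intro!: ext_norm_mult)
  finally show ?thesis by (simp add: m_def)
qed

text \<open>The endpoint 0 keeps the support projections X^0 and Y^0, so the function may jump
  there. Boundedness on the closed interval is enough.\<close>

lemma ext_norm_sandwich_interpolation:
  assumes X: "X \<in> psd_mat n" and Y: "Y \<in> psd_mat n" and K: "K \<in> carrier_mat n n" and k: "k \<le> n"
    and t: "0 < t" "t < 1"
  shows "ext_norm k (X ^\<^sub>M t * K * Y ^\<^sub>M t) \<le>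
    ext_norm k (X ^\<^sub>M 0 * K * Y ^\<^sub>M 0) powr (1 - t) * ext_norm k (X * K * Y) powr t"
proof -
  define f where "f s = ext_norm k (X ^\<^sub>M s * K * Y ^\<^sub>M s)" for s
  \<comment> \<open>Bounds \<open>f\<close> on the half-open interval (0, 1], where the norm of a
    power is the power of the norm; the point 0 is covered by \<open>f 0\<close> itself.\<close>
  define C where "C = max 1 (ext_norm k X) * (ext_norm k K * max 1 (ext_norm k Y))"
  have nn: "0 \<le> ext_norm k K" using K k by simp
  have fnn: "0 \<le> f s" for s unfolding f_def using X Y K k by (intro ext_norm_nonneg[of _ n]) auto
  have pw: "ext_norm k (Z ^\<^sub>M s) \<le> max 1 (ext_norm k Z)" if Z: "Z \<in> psd_mat n" and s: "0 < s" "s \<le> 1" for Z s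
  proof -
    have "ext_norm k (Z ^\<^sub>M s) = ext_norm k Z powr s" by (rule ext_norm_powr[OF Z k s(1)])
    also have "\<dots> \<le> max 1 (ext_norm k Z) powr s"
      using s ext_norm_nonneg[OF psd_carrier[OF Z] k] by (intro powr_mono2) auto
    also have "\<dots> \<le> max 1 (ext_norm k Z) powr 1" using s by (intro powr_mono) auto
    finally show ?thesis by simp
  qed
  have "f s \<le> max (f 0) C" if "s \<in> {0..1}" for s
  proof (cases "s = 0")
    case False
    with that have s: "0 < s" "s \<le> 1" by auto
    have "f s \<le> ext_norm k (X ^\<^sub>M s) * (ext_norm k K * ext_norm k (Y ^\<^sub>M s))"
    proof -
      have "f s = ext_norm k (X ^\<^sub>M s * (K * Y ^\<^sub>M s))"
        using X Y K by (simp add: f_def square_mult_assoc[of _ n])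
      also have "\<dots> \<le> ext_norm k (X ^\<^sub>M s) * ext_norm k (K * Y ^\<^sub>M s)"
        using X Y K k by (intro ext_norm_mult) auto
      also have "\<dots> \<le> ext_norm k (X ^\<^sub>M s) * (ext_norm k K * ext_norm k (Y ^\<^sub>M s))"
        using X Y K k by (intro mult_left_mono ext_norm_mult ext_norm_nonneg[of _ n]) auto
      finally show ?thesis .
    qed
    also have "\<dots> \<le> C" unfolding C_def
      using pw[OF X s] pw[OF Y s] X Y k nn by (intro mult_mono mult_nonneg_nonneg) (auto intro: ext_norm_nonneg[of _ n])
    finally show ?thesis by simp
  qed simp
  moreover have "(f ((s + u) / 2))\<^sup>2 \<le> f s * f u" for s u
    unfolding f_def by (rule ext_norm_sandwich_midpoint[OF X Y K k])
  ultimately have "f t \<le> f 0 powr (1 - t) * f 1 powr t"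
    using t fnn by (intro midpoint_log_convex_bound[where B = "max (f 0) C"]) auto
  then show ?thesis using X Y by (simp add: f_def)
qed

text \<open>Interpolation with the identity in the middle: the endpoint 0 is a product of two
  support projections, whose norm is at most 1.\<close>

lemma ext_norm_cordes:
  assumes X: "X \<in> psd_mat n" and Y: "Y \<in> psd_mat n" and k: "k \<le> n" and t: "0 < t" "t \<le> 1"
  shows "ext_norm k (X ^\<^sub>M t * Y ^\<^sub>M t) \<le> ext_norm k (X * Y) powr t"
proof (cases "t = 1")
  case True
  then show ?thesis using X Y k by simp
next
  case False
  with t have t1: "t < 1" by simp
  let ?z = "ext_norm k (X ^\<^sub>M 0 * Y ^\<^sub>M 0)"
  have one: "Z ^\<^sub>M s * 1\<^sub>m n = Z ^\<^sub>M s" if "Z \<in> psd_mat n" for Z s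
    using that by (intro right_mult_one_mat[of _ n n]) simp
  have "X * 1\<^sub>m n = X" using X by (intro right_mult_one_mat[of _ n n]) simp
  then have "ext_norm k (X ^\<^sub>M t * Y ^\<^sub>M t) \<le> ?z powr (1 - t) * ext_norm k (X * Y) powr t"
    using ext_norm_sandwich_interpolation[OF X Y one_carrier_mat k t(1) t1] by (simp add: one[OF X])
  also have "\<dots> \<le> 1 * ext_norm k (X * Y) powr t"
  proof (rule mult_right_mono)
    have "?z \<le> ext_norm k (X ^\<^sub>M 0) * ext_norm k (Y ^\<^sub>M 0)" using X Y k by (intro ext_norm_mult) auto
    also have "\<dots> \<le> 1 * 1"
      using X Y k by (intro mult_mono ext_norm_powr_zero_le_one) (auto intro: ext_norm_nonneg[of _ n])
    finally have "?z \<le> 1" by simp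
    then have "?z powr (1 - t) \<le> 1 powr (1 - t)"
      using X Y k t1 by (intro powr_mono2) (auto intro: ext_norm_nonneg[of _ n])
    then show "?z powr (1 - t) \<le> 1" by simp
  qed simp
  finally show ?thesis by simp
qed

section \<open>Supports and the Riccati equation\<close>

lemma mat_eq_by_vec:
  fixes A B :: "complex mat"
  assumes "A \<in> carrier_mat n n" "B \<in> carrier_mat n n"
    and "\<And>v. v \<in> carrier_vec n \<Longrightarrow> A *\<^sub>v v = B *\<^sub>v v"
  shows "A = B"
proof (rule eq_matI)
  fix i j assume "i < dim_row B" "j < dim_col B"
  then have ij: "i < n" "j < n" using assms by auto
  have dims: "dim_row A = n" "dim_col A = n" "dim_row B = n" "dim_col B = n" using assms by auto
  from assms(3)[of "unit_vec n j"] have "(A *\<^sub>v unit_vec n j) $ i = (B *\<^sub>v unit_vec n j) $ i" by simp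
  then show "A $$ (i, j) = B $$ (i, j)" using ij dims by simp
qed (use assms in auto)

text \<open>A and A^0 have the same range because A^0 is A times A^(-1). For uniqueness, idempotents
  with a common range absorb each other, and taking adjoints makes Hermitian ones equal.\<close>

lemma support_proj_psd:
  assumes A: "A \<in> psd_mat n"
  shows "support_proj A = A ^\<^sub>M 0"
proof -
  let ?V = "carrier_vec n :: complex vec set"
  have n: "dim_row A = n" using psd_carrier[OF A] by auto
  have Ac: "A \<in> carrier_mat n n" and Ar: "A ^\<^sub>M r \<in> carrier_mat n n" for r using A by auto
  have vec: "(M * N) *\<^sub>v v = M *\<^sub>v (N *\<^sub>v v)" if "M \<in> carrier_mat n n" "N \<in> carrier_mat n n" "v \<in> ?V" for M N v
    using that by (rule assoc_mult_mat_vec)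
  have ran: "(\<lambda>v. A ^\<^sub>M 0 *\<^sub>v v) ` ?V = (\<lambda>v. A *\<^sub>v v) ` ?V"
  proof (intro equalityI subsetI)
    fix w assume "w \<in> (\<lambda>v. A ^\<^sub>M 0 *\<^sub>v v) ` ?V"
    then obtain v where v: "v \<in> ?V" "w = A ^\<^sub>M 0 *\<^sub>v v" by auto
    have "w = A *\<^sub>v (A ^\<^sub>M (-1) *\<^sub>v v)"
      using powr_add_mat[OF A, of 1 "-1"] vec[OF Ac Ar[of "-1"] v(1)] A by (simp add: v)
    then show "w \<in> (\<lambda>v. A *\<^sub>v v) ` ?V" using Ar v by (auto intro: mult_mat_vec_carrier)
  next
    fix w assume "w \<in> (\<lambda>v. A *\<^sub>v v) ` ?V"
    then obtain v where v: "v \<in> ?V" "w = A *\<^sub>v v" by auto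
    have "w = A ^\<^sub>M 0 *\<^sub>v (A *\<^sub>v v)"
      using powr_add_mat[OF A, of 0 1] vec[OF Ar[of 0] Ac v(1)] A by (simp add: v)
    then show "w \<in> (\<lambda>v. A ^\<^sub>M 0 *\<^sub>v v) ` ?V" using Ac v by (auto intro: mult_mat_vec_carrier)
  qed
  have absorb: "P * Q = Q" if PQ: "P \<in> carrier_mat n n" "Q \<in> carrier_mat n n" "P * P = P"
    and ran: "(\<lambda>v. Q *\<^sub>v v) ` ?V \<subseteq> (\<lambda>v. P *\<^sub>v v) ` ?V" for P Q :: "complex mat"
  proof (rule mat_eq_by_vec[of _ n])
    fix v assume v: "v \<in> ?V"
    then obtain w where w: "w \<in> ?V" "Q *\<^sub>v v = P *\<^sub>v w" using ran by blast
    show "(P * Q) *\<^sub>v v = Q *\<^sub>v v"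
      using vec[OF PQ(1,2) v] vec[OF PQ(1,1) w(1)] by (simp add: w PQ(3))
  qed (use PQ in auto)
  show ?thesis unfolding support_proj_def n
  proof (rule the_equality)
    show "A ^\<^sub>M 0 \<in> carrier_mat n n \<and> (A ^\<^sub>M 0)\<^sup>H = A ^\<^sub>M 0 \<and> A ^\<^sub>M 0 * A ^\<^sub>M 0 = A ^\<^sub>M 0 \<and>
      (\<lambda>v. A ^\<^sub>M 0 *\<^sub>v v) ` ?V = (\<lambda>v. A *\<^sub>v v) ` ?V"
      using A ran powr_add_mat[OF A, of 0 0] by simp
  next
    fix P assume P: "P \<in> carrier_mat n n \<and> P\<^sup>H = P \<and> P * P = P \<and> (\<lambda>v. P *\<^sub>v v) ` ?V = (\<lambda>v. A *\<^sub>v v) ` ?V"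
    have "A ^\<^sub>M 0 * P = P" "P * A ^\<^sub>M 0 = A ^\<^sub>M 0"
      using absorb[of "A ^\<^sub>M 0" P] absorb[of P "A ^\<^sub>M 0"] P ran Ar powr_add_mat[OF A, of 0 0] by auto
    moreover have "(A ^\<^sub>M 0 * P)\<^sup>H = P * A ^\<^sub>M 0" using P A by (simp add: adjoint_mult[of _ n n _ n])
    ultimately show "P = A ^\<^sub>M 0" using P by simp
  qed
qed

text \<open>Every power, also of exponent at most 0, has \<open>M\<close> as a left factor.\<close>

lemma support_absorb_powr:
  assumes A: "A \<in> psd_mat n" and M: "M \<in> psd_mat n" and "A ^\<^sub>M 0 * M = M"
  shows "A ^\<^sub>M 0 * M ^\<^sub>M r = M ^\<^sub>M r" "M ^\<^sub>M r * A ^\<^sub>M 0 = M ^\<^sub>M r"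
proof -
  have "M ^\<^sub>M r = M * M ^\<^sub>M (r - 1)" using powr_add_mat[OF M, of 1 "r - 1"] M by simp
  moreover have "A ^\<^sub>M 0 * (M * M ^\<^sub>M (r - 1)) = M * M ^\<^sub>M (r - 1)"
    using square_mult_assoc[of "A ^\<^sub>M 0" n M "M ^\<^sub>M (r - 1)"] A M assms(3) by simp
  ultimately show 1: "A ^\<^sub>M 0 * M ^\<^sub>M r = M ^\<^sub>M r" by simp
  have "(A ^\<^sub>M 0 * M ^\<^sub>M r)\<^sup>H = M ^\<^sub>M r * A ^\<^sub>M 0" using A M by (simp add: adjoint_mult[of _ n n _ n])
  then show "M ^\<^sub>M r * A ^\<^sub>M 0 = M ^\<^sub>M r" using M by (simp add: 1)
qed

text \<open>Let P and Q be the support projections of \<open>A\<close> and \<open>B\<close>. If P w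
  = 0, then the form of P - Q at w is minus the squared norm of Q w, so Q w = 0. For w = v - P v
  this says Q = Q P, and the adjoint equation gives the claim.\<close>

lemma support_ge_absorb:
  assumes A: "A \<in> psd_mat n" and B: "B \<in> psd_mat n" and ge: "support_ge A B"
  shows "A ^\<^sub>M 0 * B = B"
proof -
  let ?P = "A ^\<^sub>M 0" and ?Q = "B ^\<^sub>M 0"
  have P: "?P \<in> carrier_mat n n" and Q: "?Q \<in> carrier_mat n n" using A B by auto
  have PP: "?P * ?P = ?P" and QQ: "?Q * ?Q = ?Q"
    using powr_add_mat[OF A, of 0 0] powr_add_mat[OF B, of 0 0] by auto
  have n: "dim_row A = n" using psd_carrier[OF A] by auto
  have psd: "?P - ?Q \<in> psd_mat n" using ge by (simp add: support_ge_def support_proj_psd[OF A] support_proj_psd[OF B] n)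
  have "?Q = ?Q * ?P"
  proof (rule mat_eq_by_vec[of _ n])
    fix v :: "complex vec" assume v: "v \<in> carrier_vec n"
    define w where "w = v - ?P *\<^sub>v v"
    have Pv: "?P *\<^sub>v v \<in> carrier_vec n" using P v by (rule mult_mat_vec_carrier)
    have w: "w \<in> carrier_vec n" using v Pv by (simp add: w_def)
    have Qw: "?Q *\<^sub>v w \<in> carrier_vec n" using Q w by (rule mult_mat_vec_carrier)
    have "?P *\<^sub>v w = ?P *\<^sub>v v - ?P *\<^sub>v (?P *\<^sub>v v)"
      unfolding w_def by (rule mult_minus_distrib_mat_vec[OF P v Pv])
    also have "\<dots> = 0\<^sub>v n" using assoc_mult_mat_vec[OF P P v] Pv by (simp add: PP)
    finally have Pw: "?P *\<^sub>v w = 0\<^sub>v n" .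
    have "0 \<le> ((?P - ?Q) *\<^sub>v w) \<bullet>c w" by (rule psd_form[OF psd w])
    also have "(?P - ?Q) *\<^sub>v w = - (?Q *\<^sub>v w)"
      using minus_mult_distrib_mat_vec[OF P Q w] Qw by (simp add: Pw)
    also have "(- (?Q *\<^sub>v w)) \<bullet>c w = - ((?Q *\<^sub>v w) \<bullet>c w)"
      by (rule uminus_scalar_prod[symmetric, of _ n]) (use Qw w in auto)
    also have "(?Q *\<^sub>v w) \<bullet>c w = (?Q *\<^sub>v (?Q *\<^sub>v w)) \<bullet>c w"
      using assoc_mult_mat_vec[OF Q Q w] by (simp add: QQ)
    also have "\<dots> = (?Q *\<^sub>v w) \<bullet>c (?Q *\<^sub>v w)"
      using mult_mat_vec_adjoint[OF Q Qw w] B by simp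
    finally have "(?Q *\<^sub>v w) \<bullet>c (?Q *\<^sub>v w) = 0"
      using conjugate_square_ge_0_vec[of "?Q *\<^sub>v w"] by (simp add: less_eq_complex_def complex_eq_iff)
    then have "?Q *\<^sub>v w = 0\<^sub>v n" using Qw by (simp add: conjugate_square_eq_0_vec)
    moreover have "?Q *\<^sub>v w = ?Q *\<^sub>v v - ?Q *\<^sub>v (?P *\<^sub>v v)"
      unfolding w_def by (rule mult_minus_distrib_mat_vec[OF Q v Pv])
    moreover have "?Q *\<^sub>v v \<in> carrier_vec n" "?Q *\<^sub>v (?P *\<^sub>v v) \<in> carrier_vec n"
      using Q v Pv by (auto intro: mult_mat_vec_carrier)
    ultimately have diff: "?Q *\<^sub>v v - ?Q *\<^sub>v (?P *\<^sub>v v) = 0\<^sub>v n"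
      and dims: "dim_vec (?Q *\<^sub>v v) = n" "dim_vec (?Q *\<^sub>v (?P *\<^sub>v v)) = n"
      by (metis, metis carrier_vecD, metis carrier_vecD)
    have "?Q *\<^sub>v v = ?Q *\<^sub>v (?P *\<^sub>v v)"
    proof (rule eq_vecI)
      fix i assume "i < dim_vec (?Q *\<^sub>v (?P *\<^sub>v v))"
      then show "(?Q *\<^sub>v v) $ i = (?Q *\<^sub>v (?P *\<^sub>v v)) $ i"
        using arg_cong[OF diff, of "\<lambda>x. x $ i"] dims by (simp del: index_mult_mat_vec)
    qed (simp only: dims)
    then show "?Q *\<^sub>v v = (?Q * ?P) *\<^sub>v v" using assoc_mult_mat_vec[OF Q P v] by simp
  qed (use P Q in auto)
  then have "?Q\<^sup>H = (?Q * ?P)\<^sup>H" by (rule arg_cong)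
  then have "?Q = ?P * ?Q" using A B by (simp add: adjoint_mult[of _ n n _ n])
  moreover have "B = ?Q * B" using powr_add_mat[OF B, of 0 1] B by simp
  ultimately show ?thesis using square_mult_assoc[of ?P n ?Q B] P Q B by simp
qed

text \<open>In G A^p G the powers of \<open>A\<close> between the two roots \<open>R\<close>
  collapse to A^0, which \<open>R\<close> absorbs. So the roots multiply to \<open>S\<close>, and
  the outer powers of \<open>A\<close> undo those in \<open>S\<close> on the support, which contains
  that of \<open>B\<close>.\<close>

lemma geom_mean_riccati:
  fixes p :: real
  assumes A: "A \<in> psd_mat n" and B: "B \<in> psd_mat n" and supp: "A ^\<^sub>M 0 * B = B"
  defines "G \<equiv> A ^\<^sub>M (- p) #\<^sub>M B ^\<^sub>M p"
  shows "G \<in> psd_mat n" "A ^\<^sub>M 0 * G = G" "G * A ^\<^sub>M p * G = B ^\<^sub>M p"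
proof -
  define S where "S = A ^\<^sub>M (p / 2) * B ^\<^sub>M p * A ^\<^sub>M (p / 2)"
  define R where "R = S ^\<^sub>M (1 / 2)"
  have S: "S \<in> psd_mat n"
    using psd_congruence[of "B ^\<^sub>M p" n "A ^\<^sub>M (p / 2)" n] A B by (simp add: S_def)
  then have R: "R \<in> psd_mat n" by (simp add: R_def)
  have G: "G = A ^\<^sub>M (- (p / 2)) * R * A ^\<^sub>M (- (p / 2))"
    using powr_powr_mat[OF A] by (simp add: G_def geom_mean_def R_def S_def)
  show "G \<in> psd_mat n"
    using psd_congruence[OF R, of "A ^\<^sub>M (- (p / 2))" n] A by (simp add: G)
  show "A ^\<^sub>M 0 * G = G"
    unfolding G using A R by (simp add: square_mult_assoc[of _ n] powr_add_mat_assoc[of _ n])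
  have "A ^\<^sub>M 0 * S = S"
    unfolding S_def using A B by (simp add: square_mult_assoc[of _ n] powr_add_mat_assoc[of _ n])
  note AR = support_absorb_powr(1)[OF A S this, of "1/2", folded R_def]
  have RR: "R * (R * M) = S * M" if "M \<in> carrier_mat n n" for M
    unfolding R_def using S that by (simp add: powr_add_mat_assoc[of _ n])
  have "G * A ^\<^sub>M p * G = A ^\<^sub>M (- (p / 2)) * (R * (A ^\<^sub>M 0 * R * A ^\<^sub>M (- (p / 2))))"
    unfolding G using A R by (simp add: square_mult_assoc[of _ n] powr_add_mat_assoc[of _ n])
  also have "\<dots> = A ^\<^sub>M (- (p / 2)) * (S * A ^\<^sub>M (- (p / 2)))"
    unfolding AR using A by (simp add: RR)
  also have "\<dots> = A ^\<^sub>M 0 * B ^\<^sub>M p * A ^\<^sub>M 0"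
    unfolding S_def using A B by (simp add: square_mult_assoc[of _ n] powr_add_mat_assoc[of _ n] powr_add_mat[of _ n])
  also have "\<dots> = B ^\<^sub>M p" using support_absorb_powr[OF A B supp, of p] by simp
  finally show "G * A ^\<^sub>M p * G = B ^\<^sub>M p" .
qed

text \<open>The matrices at the parameters 1 - \<alpha> and \<alpha> are adjoint to each other, so
  both endpoint norms agree and interpolation between them yields that common value.\<close>

lemma ext_norm_interpolation_twisted:
  assumes A: "A \<in> psd_mat n" and G: "G \<in> psd_mat n" and k: "k \<le> n"
    and \<alpha>: "\<alpha> > 1" and s: "1 - \<alpha> \<le> s" "s \<le> \<alpha>"
  shows "ext_norm k (A ^\<^sub>M (e * s) * G * A ^\<^sub>M (e * (1 - s))) \<le>
    ext_norm k (A ^\<^sub>M (e * (1 - \<alpha>)) * G * A ^\<^sub>M (e * \<alpha>))"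
proof -
  define g where "g s = ext_norm k (A ^\<^sub>M (e * s) * G * A ^\<^sub>M (e * (1 - s)))" for s
  have sym: "g \<alpha> = g (1 - \<alpha>)"
    using ext_norm_adjoint[of "A ^\<^sub>M (e * (1 - \<alpha>)) * G * A ^\<^sub>M (e * \<alpha>)" n k] A G k
    by (simp add: g_def adjoint_mult[of _ n n _ n] square_mult_assoc[of _ n] psd_hermitian[OF G])
  have "g s \<le> g (1 - \<alpha>)"
  proof (cases "s = 1 - \<alpha> \<or> s = \<alpha>")
    case True
    then show ?thesis using sym by auto
  next
    case False
    \<comment> \<open>Affine parameter taking 1 - \<alpha> to 0 and \<alpha> to 1; \<open>X\<close>
      and \<open>Y\<close> below carry the total change of the two exponents.\<close>
    define t where "t = (s - (1 - \<alpha>)) / (2 * \<alpha> - 1)"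
    have t: "0 < t" "t < 1" using False s \<alpha> by (auto simp: t_def field_simps)
    have st: "(2 * \<alpha> - 1) * t = s - (1 - \<alpha>)" using \<alpha> by (simp add: t_def)
    define X where "X = A ^\<^sub>M (e * (2 * \<alpha> - 1))"
    define Y where "Y = A ^\<^sub>M (- (e * (2 * \<alpha> - 1)))"
    define K where "K = A ^\<^sub>M (e * (1 - \<alpha>)) * G * A ^\<^sub>M (e * \<alpha>)"
    have XY: "X \<in> psd_mat n" "Y \<in> psd_mat n" and K: "K \<in> carrier_mat n n"
      using A G by (auto simp: X_def Y_def K_def)
    have exps: "e * (2 * \<alpha> - 1) * t + e * (1 - \<alpha>) = e * s" "e * \<alpha> + - (e * (2 * \<alpha> - 1)) * t = e * (1 - s)"
      "e * (2 * \<alpha> - 1) + e * (1 - \<alpha>) = e * \<alpha>" "e * \<alpha> + - (e * (2 * \<alpha> - 1)) = e * (1 - \<alpha>)"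
      using arg_cong[OF st, of "\<lambda>x. e * x"] by (auto simp: algebra_simps)
    have sandwich: "A ^\<^sub>M x * K * A ^\<^sub>M y = A ^\<^sub>M (x + e * (1 - \<alpha>)) * G * A ^\<^sub>M (e * \<alpha> + y)" for x y
      unfolding K_def using A G
      by (simp add: square_mult_assoc[of _ n] powr_add_mat_assoc[of _ n] powr_add_mat[of _ n])
    have "g s = ext_norm k (X ^\<^sub>M t * K * Y ^\<^sub>M t)"
      unfolding X_def Y_def powr_powr_mat[OF A] sandwich exps g_def ..
    also have "\<dots> \<le> ext_norm k (X ^\<^sub>M 0 * K * Y ^\<^sub>M 0) powr (1 - t) * ext_norm k (X * K * Y) powr t"
      by (rule ext_norm_sandwich_interpolation[OF XY K k t])
    also have "X ^\<^sub>M 0 * K * Y ^\<^sub>M 0 = K"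
      \<comment> \<open>\<open>K\<close> begins and ends with powers of \<open>A\<close>, so the
        support projections at the endpoint 0 change nothing.\<close>
      unfolding X_def Y_def powr_powr_mat[OF A] sandwich by (simp add: K_def)
    also have "X * K * Y = A ^\<^sub>M (e * \<alpha>) * G * A ^\<^sub>M (e * (1 - \<alpha>))"
      unfolding X_def Y_def sandwich exps ..
    also have "ext_norm k K = g (1 - \<alpha>)" by (simp add: K_def g_def)
    also have "ext_norm k (A ^\<^sub>M (e * \<alpha>) * G * A ^\<^sub>M (e * (1 - \<alpha>))) = g (1 - \<alpha>)"
      using sym by (simp add: g_def)
    also have "g (1 - \<alpha>) powr (1 - t) * g (1 - \<alpha>) powr t = g (1 - \<alpha>)"
    proof -
      have "0 \<le> g (1 - \<alpha>)" unfolding g_def using A G k by (intro ext_norm_nonneg[of _ n]) auto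
      then show ?thesis by (simp flip: powr_add)
    qed
    finally show ?thesis .
  qed
  then show ?thesis by (simp add: g_def)
qed

text \<open>The factors \<open>T\<^sup>s G T\<^sup>1\<^sup>-\<^sup>s\<close> for \<open>s = \<alpha>, \<alpha> - 1, \<dots>\<close> (where \<open>T\<close> is \<open>A\<^sup>e\<close>) telescope to
  \<open>T\<^sup>\<alpha> G\<^sup>\<alpha>\<close>, up to a last factor with an exponent in \<open>(0, 1]\<close>.\<close>

lemma ext_norm_powr_mult_le:
  assumes A: "A \<in> psd_mat n" and G: "G \<in> psd_mat n" and supp: "A ^\<^sub>M 0 * G = G" and k: "k \<le> n" and \<alpha>: "\<alpha> > 1"
  shows "ext_norm k (A ^\<^sub>M (e * \<alpha>) * G ^\<^sub>M \<alpha>) \<le>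
    ext_norm k (A ^\<^sub>M (e * (1 - \<alpha>)) * G * A ^\<^sub>M (e * \<alpha>)) powr \<alpha>"
proof -
  define c where "c = ext_norm k (A ^\<^sub>M (e * (1 - \<alpha>)) * G * A ^\<^sub>M (e * \<alpha>))"
  have c: "0 \<le> c" unfolding c_def using A G k by (intro ext_norm_nonneg[of _ n]) auto
  have g: "ext_norm k (A ^\<^sub>M (e * s) * G * A ^\<^sub>M (e * (1 - s))) \<le> c" if "1 - \<alpha> \<le> s" "s \<le> \<alpha>" for s
    unfolding c_def by (rule ext_norm_interpolation_twisted[OF A G k \<alpha> that])
  have GA: "G * (A ^\<^sub>M 0 * M) = G * M" if "M \<in> carrier_mat n n" for M
    using square_mult_assoc[of G n "A ^\<^sub>M 0" M] support_absorb_powr(2)[OF A G supp, of 1] A G that by simp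
  have GG: "G * G ^\<^sub>M r = G ^\<^sub>M (r + 1)" for r using powr_add_mat[OF G, of 1 r] G by (simp add: add.commute)
  \<comment> \<open>Ceiling minus one rather than floor, so that \<theta> is 1 and not 0 when
    \<alpha> is an integer; the Cordes inequality needs a positive exponent.\<close>
  define m where "m = nat (\<lceil>\<alpha>\<rceil> - 1)"
  define \<theta> where "\<theta> = \<alpha> - m"
  have m: "real m = \<lceil>\<alpha>\<rceil> - 1"
  proof -
    have "1 \<le> \<lceil>\<alpha>\<rceil>" using \<alpha> by linarith
    then show ?thesis by (simp add: m_def)
  qed
  have \<theta>: "0 < \<theta>" "\<theta> \<le> 1" unfolding \<theta>_def m by linarith+
  have chain: "ext_norm k (A ^\<^sub>M (e * (\<theta> + j)) * G ^\<^sub>M (\<theta> + j)) \<le> c ^ j * c powr \<theta>" if "j \<le> m" for j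
    using that
  proof (induction j)
    case 0
    have "A ^\<^sub>M (e * \<theta>) = (A ^\<^sub>M e) ^\<^sub>M \<theta>" by (simp add: powr_powr_mat[OF A])
    then have "ext_norm k (A ^\<^sub>M (e * \<theta>) * G ^\<^sub>M \<theta>) \<le> ext_norm k (A ^\<^sub>M e * G) powr \<theta>"
      using ext_norm_cordes[of "A ^\<^sub>M e" n G k \<theta>] A G k \<theta> by simp
    \<comment> \<open>The twisted factor with parameter 1, whose trailing A^0 is absorbed by
      \<open>G\<close>.\<close>
    also have "A ^\<^sub>M e * G = A ^\<^sub>M (e * 1) * G * A ^\<^sub>M (e * (1 - 1))"
      using support_absorb_powr(2)[OF A G supp, of 1] A G by (simp add: square_mult_assoc[of _ n])
    also have "ext_norm k \<dots> powr \<theta> \<le> c powr \<theta>"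
      using A G k \<alpha> \<theta> by (intro powr_mono2 g ext_norm_nonneg[of _ n]) auto
    finally show ?case by simp
  next
    case (Suc j)
    define s where "s = \<theta> + real (Suc j)"
    have s: "1 - \<alpha> \<le> s" "s \<le> \<alpha>" using \<theta> \<alpha> Suc.prems by (auto simp: s_def \<theta>_def)
    have e0: "e * (1 - s) + e * (\<theta> + real j) = 0" "s - 1 = \<theta> + real j" by (auto simp: s_def algebra_simps)
    have "A ^\<^sub>M (e * s) * G ^\<^sub>M s = A ^\<^sub>M (e * s) * (G * (A ^\<^sub>M 0 * G ^\<^sub>M (s - 1)))"
      using A G by (simp add: GA GG)
    \<comment> \<open>The inserted A^0 is split into opposite powers of \<open>A\<close>: one
      completes the twisted factor at \<open>s\<close>, the other restores the previous
      product.\<close>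
    also have "\<dots> = (A ^\<^sub>M (e * s) * G * A ^\<^sub>M (e * (1 - s))) * (A ^\<^sub>M (e * (\<theta> + j)) * G ^\<^sub>M (\<theta> + j))"
      using A G by (simp add: square_mult_assoc[of _ n] powr_add_mat_assoc[of _ n] e0)
    finally have "ext_norm k (A ^\<^sub>M (e * s) * G ^\<^sub>M s) \<le>
        ext_norm k (A ^\<^sub>M (e * s) * G * A ^\<^sub>M (e * (1 - s))) * ext_norm k (A ^\<^sub>M (e * (\<theta> + j)) * G ^\<^sub>M (\<theta> + j))"
      using A G k by (simp add: ext_norm_mult[of _ n])
    also have "\<dots> \<le> c * (c ^ j * c powr \<theta>)"
      using Suc A G k c by (intro mult_mono g s) (auto intro!: ext_norm_nonneg[of _ n])
    finally show ?case by (simp add: s_def mult.assoc)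
  qed
  have "ext_norm k (A ^\<^sub>M (e * \<alpha>) * G ^\<^sub>M \<alpha>) \<le> c ^ m * c powr \<theta>"
    using chain[of m] by (simp add: \<theta>_def)
  also have "\<dots> = c powr \<alpha>"
  proof (cases "c = 0")
    case False
    with c have "c ^ m * c powr \<theta> = c powr (real m + \<theta>)" by (simp add: powr_add powr_realpow)
    then show ?thesis by (simp add: \<theta>_def)
  qed simp
  finally show ?thesis by (simp add: c_def)
qed

section \<open>The log-majorization\<close>

lemma eigprod_powr:
  assumes "P \<in> psd_mat n" "k \<le> n" "0 < r"
  shows "eigprod k (P ^\<^sub>M r) = eigprod k P powr r"
  using ext_norm_powr[OF assms] ext_norm_psd[OF assms(1,2)] ext_norm_psd[OF psd_powr[OF assms(1)] assms(2)] by simp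

text \<open>Both means are roots of Gram matrices; this translates their eigenvalue products into
  powers of \<open>ext_norm\<close>.\<close>

lemma eigprod_gram_powr:
  assumes M: "M \<in> carrier_mat n n" and k: "k \<le> n" and r: "0 < r"
  shows "eigprod k ((M\<^sup>H * M) ^\<^sub>M r) = ext_norm k M powr (2 * r)"
proof -
  have "eigprod k ((M\<^sup>H * M) ^\<^sub>M r) = (ext_norm k M)\<^sup>2 powr r"
    by (simp add: eigprod_powr[OF psd_gram[OF M] k r] ext_norm_sq[OF M k])
  also have "\<dots> = ext_norm k M powr (2 * r)"
    using ext_norm_nonneg[OF M k] by (simp add: powr_powr flip: powr_numeral)
  finally show ?thesis .
qed

lemma SG_mean_eq_gram:
  fixes p \<alpha> :: real
  assumes A: "A \<in> psd_mat n" and B: "B \<in> psd_mat n" and supp: "A ^\<^sub>M 0 * B = B"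
  defines "S \<equiv> A ^\<^sub>M (p / 2) * (A ^\<^sub>M (- p) #\<^sub>M B ^\<^sub>M p) ^\<^sub>M \<alpha>"
  shows "SG_mean \<alpha> p A B = (S\<^sup>H * S) ^\<^sub>M (1 / p)"
proof -
  define G where "G = A ^\<^sub>M (- p) #\<^sub>M B ^\<^sub>M p"
  have G: "G \<in> psd_mat n" unfolding G_def by (rule geom_mean_riccati(1)[OF A B supp])
  have "S\<^sup>H * S = G ^\<^sub>M \<alpha> * A ^\<^sub>M p * G ^\<^sub>M \<alpha>"
    unfolding S_def G_def[symmetric] using A G
    by (simp add: adjoint_mult[of _ n n _ n] square_mult_assoc[of _ n] powr_add_mat_assoc[of _ n])
  then show ?thesis by (simp add: SG_mean_def G_def)
qed

lemma eigprod_SG_le_Renyi: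
  assumes A: "A \<in> psd_mat n" and B: "B \<in> psd_mat n" and supp: "A ^\<^sub>M 0 * B = B" and k: "k \<le> n"
    and \<alpha>: "\<alpha> > 1" and p: "p > 0" and q: "q > 0" and pq: "p / q \<le> \<alpha>"
  shows "eigprod k (SG_mean \<alpha> p A B) \<le> eigprod k (Renyi_mean \<alpha> q A B)"
proof -
  define G where "G = A ^\<^sub>M (- p) #\<^sub>M B ^\<^sub>M p"
  note G = geom_mean_riccati[OF A B supp, of p, folded G_def]
  \<comment> \<open>Chosen so that e \<alpha> = p / 2: then the matrix in \<open>c\<close>,
    multiplied by its adjoint, contains G A^p G, and \<open>S\<close> is the Gram root of the
    spectral geometric mean.\<close>
  define e where "e = p / (2 * \<alpha>)"
  have e\<alpha>: "e * \<alpha> = p / 2" using \<alpha> by (simp add: e_def)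
  define c where "c = ext_norm k (A ^\<^sub>M (e * (1 - \<alpha>)) * G * A ^\<^sub>M (e * \<alpha>))"
  define N where "N = B ^\<^sub>M (\<alpha> * q / 2) * A ^\<^sub>M ((1 - \<alpha>) / 2 * q)"
  define S where "S = A ^\<^sub>M (e * \<alpha>) * G ^\<^sub>M \<alpha>"
  have carr: "N \<in> carrier_mat n n" "S \<in> carrier_mat n n" using A B G(1) by (auto simp: N_def S_def)
  have nonneg: "0 \<le> c" "0 \<le> ext_norm k N" "0 \<le> ext_norm k S"
    unfolding c_def using A G(1) k carr by (auto intro!: ext_norm_nonneg[of _ n])
  note root = eigprod_gram_powr[OF _ k]
  have SG: "SG_mean \<alpha> p A B = (S\<^sup>H * S) ^\<^sub>M (1 / p)"
    unfolding S_def e\<alpha> G_def by (rule SG_mean_eq_gram[OF A B supp])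
  have R: "Renyi_mean \<alpha> q A B = (N\<^sup>H * N) ^\<^sub>M (1 / q)"
  proof -
    have "N\<^sup>H * N = A ^\<^sub>M ((1 - \<alpha>) / 2 * q) * B ^\<^sub>M (\<alpha> * q) * A ^\<^sub>M ((1 - \<alpha>) / 2 * q)"
      unfolding N_def using A B
      by (simp add: adjoint_mult[of _ n n _ n] square_mult_assoc[of _ n] powr_add_mat_assoc[of _ n])
    then show ?thesis by (simp add: Renyi_mean_def)
  qed
  have "c = ext_norm k (B ^\<^sub>M (p / 2) * A ^\<^sub>M (e * (1 - \<alpha>)))"
  proof (rule power2_eq_imp_eq)
    let ?M = "A ^\<^sub>M (e * (1 - \<alpha>)) * G * A ^\<^sub>M (e * \<alpha>)"
    let ?N = "B ^\<^sub>M (p / 2) * A ^\<^sub>M (e * (1 - \<alpha>))"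
    have M: "?M \<in> carrier_mat n n" and N: "?N \<in> carrier_mat n n" using A B G(1) by auto
    \<comment> \<open>Here the Riccati equation eliminates \<open>G\<close>.\<close>
    have "?M * ?M\<^sup>H = A ^\<^sub>M (e * (1 - \<alpha>)) * (G * A ^\<^sub>M p * G) * A ^\<^sub>M (e * (1 - \<alpha>))"
      using A G(1)
      by (simp add: adjoint_mult[of _ n n _ n] square_mult_assoc[of _ n] powr_add_mat_assoc[of _ n] psd_hermitian[OF G(1)] e\<alpha>)
    also have "\<dots> = ?N\<^sup>H * ?N"
      unfolding G(3) using A B
      by (simp add: adjoint_mult[of _ n n _ n] square_mult_assoc[of _ n] powr_add_mat_assoc[of _ n])
    finally show "c\<^sup>2 = (ext_norm k ?N)\<^sup>2"
      using ext_norm_gram[OF N k] ext_norm_gram[of "?M\<^sup>H" n k] ext_norm_adjoint[OF M k] M k by (simp add: c_def)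
  qed (use nonneg A B k in \<open>auto intro!: ext_norm_nonneg[of _ n]\<close>)
  also have "\<dots> \<le> ext_norm k N powr (p / (\<alpha> * q))"
  proof -
    \<comment> \<open>One ratio p / (\<alpha> q) scales both exponents of \<open>N\<close> to those
      needed. It is at most 1 exactly by the hypothesis \<open>pq\<close>, as the Cordes inequality
      requires.\<close>
    have "\<alpha> * q / 2 * (p / (\<alpha> * q)) = p / 2" "(1 - \<alpha>) / 2 * q * (p / (\<alpha> * q)) = e * (1 - \<alpha>)"
      using \<alpha> q by (simp_all add: e_def field_simps)
    then have "B ^\<^sub>M (p / 2) = (B ^\<^sub>M (\<alpha> * q / 2)) ^\<^sub>M (p / (\<alpha> * q))"
      "A ^\<^sub>M (e * (1 - \<alpha>)) = (A ^\<^sub>M ((1 - \<alpha>) / 2 * q)) ^\<^sub>M (p / (\<alpha> * q))"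
      by (simp_all only: powr_powr_mat[OF A] powr_powr_mat[OF B])
    moreover have "0 < p / (\<alpha> * q)" "p / (\<alpha> * q) \<le> 1" using \<alpha> p q pq by (auto simp: field_simps)
    ultimately show ?thesis
      unfolding N_def using ext_norm_cordes[of "B ^\<^sub>M (\<alpha> * q / 2)" n "A ^\<^sub>M ((1 - \<alpha>) / 2 * q)" k "p / (\<alpha> * q)"] A B k
      by simp
  qed
  finally have cN: "c \<le> ext_norm k N powr (p / (\<alpha> * q))" .
  have "eigprod k (SG_mean \<alpha> p A B) = ext_norm k S powr (2 * (1 / p))"
    unfolding SG using p by (intro root carr) simp
  also have "\<dots> \<le> (c powr \<alpha>) powr (2 * (1 / p))"
    unfolding c_def S_def using ext_norm_powr_mult_le[OF A G(1,2) k \<alpha>, of e] nonneg(3) p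
    by (intro powr_mono2) (auto simp: S_def)
  also have "\<dots> \<le> ((ext_norm k N powr (p / (\<alpha> * q))) powr \<alpha>) powr (2 * (1 / p))"
    using cN nonneg(1) \<alpha> p by (intro powr_mono2) auto
  \<comment> \<open>The exponents p / (\<alpha> q), \<alpha> and 2 / p multiply to 2 / q.\<close>
  also have "\<dots> = ext_norm k N powr (2 * (1 / q))"
    using \<alpha> p by (simp add: powr_powr)
  also have "\<dots> = eigprod k (Renyi_mean \<alpha> q A B)"
    unfolding R using q by (intro root[symmetric] carr) simp
  finally show ?thesis .
qed

lemma mean_psd:
  assumes A: "A \<in> psd_mat n" and B: "B \<in> psd_mat n" and supp: "A ^\<^sub>M 0 * B = B"
  shows "SG_mean \<alpha> p A B \<in> psd_mat n" "Renyi_mean \<alpha> q A B \<in> psd_mat n"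
proof -
  have sandwich: "X * Y * X \<in> psd_mat n" if "X \<in> psd_mat n" "Y \<in> psd_mat n" for X Y
    using psd_congruence[OF that(2) psd_carrier[OF that(1)]] by (simp add: psd_hermitian[OF that(1)])
  show "SG_mean \<alpha> p A B \<in> psd_mat n"
    unfolding SG_mean_def using geom_mean_riccati(1)[OF A B supp] A by (auto intro!: sandwich psd_powr)
  show "Renyi_mean \<alpha> q A B \<in> psd_mat n"
    unfolding Renyi_mean_def using A B by (auto intro!: sandwich psd_powr)
qed

text \<open>For k = n these are determinants. The Riccati equation expresses det G through det A and
  det B; for nonsingular \<open>A\<close> both sides become (det B)^\<alpha> (det A)^(1 -
  \<alpha>).\<close>

lemma eigprod_SG_eq_Renyi:
  assumes A: "A \<in> psd_mat n" and B: "B \<in> psd_mat n" and supp: "A ^\<^sub>M 0 * B = B"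
    and p: "p > 0" and q: "q > 0"
  shows "eigprod n (SG_mean \<alpha> p A B) = eigprod n (Renyi_mean \<alpha> q A B)"
proof -
  define G where "G = A ^\<^sub>M (- p) #\<^sub>M B ^\<^sub>M p"
  note G = geom_mean_riccati[OF A B supp, of p, folded G_def]
  define a b g where "a = Re (det A)" "b = Re (det B)" "g = Re (det G)"
  have nn: "0 \<le> a" "0 \<le> b" "0 \<le> g"
    using eigprod_full[OF A] eigprod_full[OF B] eigprod_full[OF G(1)] eigprod_nonneg A B G(1)
    by (auto simp: a_b_g_def)
  have sandwich: "X * Y * X \<in> psd_mat n" if "X \<in> psd_mat n" "Y \<in> psd_mat n" for X Y
    using psd_congruence[OF that(2) psd_carrier[OF that(1)]] by (simp add: psd_hermitian[OF that(1)])
  have det3: "Re (det (X * Y * X)) = Re (det X) * Re (det Y) * Re (det X)"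
    if "X \<in> psd_mat n" "Y \<in> psd_mat n" for X Y
    using that by (simp add: det_mult[of _ n] eigprod_full)
  have dp: "Re (det (X ^\<^sub>M r)) = Re (det X) powr r" if "X \<in> psd_mat n" for X r
    using that by (simp add: det_powr)
  have eig: "eigprod n X = Re (det X)" if "X \<in> psd_mat n" for X using eigprod_full[OF that] by simp
  have SG: "eigprod n (SG_mean \<alpha> p A B) = (g powr \<alpha> * a powr p * g powr \<alpha>) powr (1 / p)"
    unfolding eig[OF mean_psd(1)[OF A B supp]]
    using A G(1) by (simp add: SG_mean_def G_def[symmetric] dp sandwich det3 a_b_g_def)
  have R: "eigprod n (Renyi_mean \<alpha> q A B) =
      (a powr ((1 - \<alpha>) / 2 * q) * b powr (\<alpha> * q) * a powr ((1 - \<alpha>) / 2 * q)) powr (1 / q)"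
    unfolding eig[OF mean_psd(2)[OF A B supp]]
    using A B by (simp add: Renyi_mean_def dp sandwich det3 a_b_g_def)
  have gag: "g * a powr p * g = b powr p"
    using arg_cong[OF G(3), of "\<lambda>M. Re (det M)"] A B G(1) by (simp add: dp det3 a_b_g_def)
  show ?thesis
  proof (cases "a = 0")
    \<comment> \<open>A factor \<open>0 powr r\<close> makes both sides vanish, whatever the sign of
      the exponent.\<close>
    case True
    then show ?thesis by (simp add: SG R)
  next
    case False
    then have a: "0 < a" using nn by simp
    have "g powr \<alpha> * a powr p * g powr \<alpha> = (g * a powr p * g) powr \<alpha> * a powr (p - p * \<alpha>)"
      using nn a by (simp add: powr_mult powr_powr mult_ac flip: powr_add)
    also have "\<dots> powr (1 / p) = b powr \<alpha> * a powr (1 - \<alpha>)"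
    proof -
      have "(p - p * \<alpha>) * (1 / p) = 1 - \<alpha>" "p * \<alpha> * (1 / p) = \<alpha>" using p by (simp_all add: field_simps)
      then show ?thesis using nn a unfolding gag by (simp only: powr_mult powr_powr powr_ge_zero)
    qed
    finally have "eigprod n (SG_mean \<alpha> p A B) = b powr \<alpha> * a powr (1 - \<alpha>)" by (simp add: SG)
    moreover have "eigprod n (Renyi_mean \<alpha> q A B) = b powr \<alpha> * a powr (1 - \<alpha>)"
    proof -
      have "a powr ((1 - \<alpha>) / 2 * q) * b powr (\<alpha> * q) * a powr ((1 - \<alpha>) / 2 * q) =
          b powr (\<alpha> * q) * a powr ((1 - \<alpha>) * q)"
        by (simp add: mult_ac flip: powr_add)
      then show ?thesis using nn a q unfolding R by (simp only: powr_mult powr_powr powr_ge_zero) simp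
    qed
    ultimately show ?thesis by simp
  qed
qed

lemma SG_log_majorized_Renyi:
  assumes A: "A \<in> psd_mat n" and B: "B \<in> psd_mat n" and ge: "support_ge A B"
    and \<alpha>: "\<alpha> > 1" and p: "p > 0" and q: "q > 0" and pq: "p / q \<le> \<alpha>"
  shows "SG_mean \<alpha> p A B \<prec>\<^sub>l\<^sub>o\<^sub>g Renyi_mean \<alpha> q A B"
proof -
  note supp = support_ge_absorb[OF A B ge]
  have "dim_row (SG_mean \<alpha> p A B) = n" using psd_carrier[OF mean_psd(1)[OF A B supp]] by auto
  then show ?thesis
    using eigprod_SG_le_Renyi[OF A B supp _ \<alpha> p q pq] eigprod_SG_eq_Renyi[OF A B supp p q]
    by (auto simp: log_majorized_def eigprod_def)
qed

section \<open>The counterexamples\<close>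

text \<open>The form at \<open>v\<close> is the squared norm of A^(1/2) v, and A^(-1/2) inverts
  A^(1/2) once A^0 is the identity.\<close>

lemma psd_pd:
  assumes A: "A \<in> psd_mat n" and "A ^\<^sub>M 0 = 1\<^sub>m n"
  shows "A \<in> pd_mat n"
proof -
  let ?S = "A ^\<^sub>M (1 / 2)"
  have S: "?S \<in> carrier_mat n n" and Ai: "A ^\<^sub>M (-1/2) \<in> carrier_mat n n" using A by auto
  have "0 < (A *\<^sub>v v) \<bullet>c v" if v: "v \<in> carrier_vec n" "v \<noteq> 0\<^sub>v n" for v
  proof -
    have Sv: "?S *\<^sub>v v \<in> carrier_vec n" using S v by (auto intro: mult_mat_vec_carrier)
    have "A *\<^sub>v v = ?S *\<^sub>v (?S *\<^sub>v v)"
      using powr_add_mat[OF A, of "1/2" "1/2"] assoc_mult_mat_vec[OF S S v(1)] A by simp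
    then have eq: "(A *\<^sub>v v) \<bullet>c v = (?S *\<^sub>v v) \<bullet>c (?S *\<^sub>v v)"
      using mult_mat_vec_adjoint[OF S Sv v(1)] A by simp
    have "?S *\<^sub>v v \<noteq> 0\<^sub>v n"
    proof
      assume "?S *\<^sub>v v = 0\<^sub>v n"
      then have "A ^\<^sub>M (-1/2) *\<^sub>v (?S *\<^sub>v v) = 0\<^sub>v n"
        using Ai by (intro eq_vecI) (auto simp: scalar_prod_def)
      moreover have "A ^\<^sub>M (-1/2) *\<^sub>v (?S *\<^sub>v v) = v"
        using powr_add_mat[OF A, of "-1/2" "1/2"] assoc_mult_mat_vec[OF Ai S v(1)] assms(2) v by simp
      ultimately show False using v by simp
    qed
    then show ?thesis unfolding eq using Sv by (subst conjugate_square_greater_0_vec[of _ n]) auto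
  qed
  then show ?thesis using A by (auto simp: pd_mat_def)
qed

section \<open>Bounds for the largest eigenvalue by diagonal entries\<close>

lemma spectral_diag:
  assumes "spectral n A U d" "i < n"
  shows "A $$ (i, i) = complex_of_real (\<Sum>j<n. d j * (cmod (U $$ (i, j)))\<^sup>2)"
proof -
  have U: "U \<in> carrier_mat n n" and A: "A = U * rdiag n d * U\<^sup>H" using assms by (auto simp: spectral_def)
  have "A $$ (i, i) = (\<Sum>j<n. U $$ (i, j) * d j * cnj (U $$ (i, j)))"
    unfolding A using U assms(2)
    by (simp add: mat_diag_mult_right[of _ n n] scalar_prod_def atLeast0LessThan)
  also have "\<dots> = (\<Sum>j<n. complex_of_real (d j * (cmod (U $$ (i, j)))\<^sup>2))"
    by (intro sum.cong refl) (simp only: of_real_mult complex_norm_square mult_ac)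
  finally show ?thesis by simp
qed

lemma unitary_norms:
  assumes "unitary n U" "i < n"
  shows "(\<Sum>j<n. (cmod (U $$ (i, j)))\<^sup>2) = 1" "(\<Sum>j<n. (cmod (U $$ (j, i)))\<^sup>2) = 1"
proof -
  have U: "U \<in> carrier_mat n n" using assms by simp
  have "complex_of_real (\<Sum>j<n. (cmod (U $$ (i, j)))\<^sup>2) = (U * U\<^sup>H) $$ (i, i)"
    using U assms(2) by (simp add: scalar_prod_def atLeast0LessThan complex_norm_square del: of_real_power)
  then show "(\<Sum>j<n. (cmod (U $$ (i, j)))\<^sup>2) = 1"
    using assms(2) unfolding unitary_right[OF assms(1)] by (metis index_one_mat(1) of_real_eq_1_iff)
  have "complex_of_real (\<Sum>j<n. (cmod (U $$ (j, i)))\<^sup>2) = (U\<^sup>H * U) $$ (i, i)"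
    using U assms(2)
    by (simp add: scalar_prod_def atLeast0LessThan complex_norm_square mult.commute del: of_real_power)
  then show "(\<Sum>j<n. (cmod (U $$ (j, i)))\<^sup>2) = 1"
    using assms(2) unfolding unitary_left[OF assms(1)] by (metis index_one_mat(1) of_real_eq_1_iff)
qed

text \<open>A diagonal entry is a convex combination of the eigenvalues, with the squared moduli of
  a row of the unitary as weights.\<close>

lemma diag_le_eigprod_1:
  assumes P: "P \<in> psd_mat n" and i: "i < n"
  shows "Re (P $$ (i, i)) \<le> eigprod 1 P"
proof -
  obtain U d where sp: "spectral n P U d" and d: "decreasing_nonneg n d" by (rule psd_spectral[OF P])
  have "Re (P $$ (i, i)) = (\<Sum>j<n. d j * (cmod (U $$ (i, j)))\<^sup>2)" by (simp add: spectral_diag[OF sp i])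
  also have "\<dots> \<le> (\<Sum>j<n. d 0 * (cmod (U $$ (i, j)))\<^sup>2)"
    by (intro sum_mono mult_right_mono decreasing_nonnegD(1)[OF d]) auto
  also have "\<dots> = d 0" using unitary_norms(1)[OF spectral_unitary[OF sp] i] by (simp flip: sum_distrib_left)
  also have "\<dots> = eigprod 1 P" using spectral_eigprod[OF sp d, of 1] i by simp
  finally show ?thesis .
qed

lemma eigprod_1_le_trace:
  assumes P: "P \<in> psd_mat n" and n: "0 < n"
  shows "eigprod 1 P \<le> (\<Sum>i<n. Re (P $$ (i, i)))"
proof -
  obtain U d where sp: "spectral n P U d" and d: "decreasing_nonneg n d" by (rule psd_spectral[OF P])
  have "eigprod 1 P = d 0" using spectral_eigprod[OF sp d, of 1] n by simp
  also have "\<dots> \<le> (\<Sum>j<n. d j)"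
    using n decreasing_nonnegD(2)[OF d] by (intro member_le_sum[of 0 _ d]) auto
  also have "\<dots> = (\<Sum>j<n. d j * (\<Sum>i<n. (cmod (U $$ (i, j)))\<^sup>2))"
    using unitary_norms(2)[OF spectral_unitary[OF sp]] by simp
  also have "\<dots> = (\<Sum>i<n. Re (P $$ (i, i)))"
    unfolding sum_distrib_left by (subst sum.swap) (simp add: spectral_diag[OF sp])
  finally show ?thesis .
qed

lemma det_2x2:
  fixes M :: "complex mat"
  assumes "M \<in> carrier_mat 2 2"
  shows "det M = M $$ (0, 0) * M $$ (1, 1) - M $$ (0, 1) * M $$ (1, 0)"
proof -
  have "det M = (\<Sum>j<2. M $$ (0, j) * cofactor M 0 j)"
    by (rule laplace_expansion_row[OF assms]) simp
  then show ?thesis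
    using assms by (simp add: numeral_2_eq_2 cofactor_def det_single mat_delete_def)
qed

text \<open>The test pair is \<open>A = diag(1, a)\<close> and its image \<open>B\<close> under the reflection below. As
  \<open>a \<rightarrow> 0\<close>, \<open>B\<close> tends to a rank one projection in general position to \<open>A\<close>: then
  \<open>A\<^sup>-\<^sup>p # B\<^sup>p\<close> stays bounded, whereas \<open>R\<close> contains a negative power of \<open>a\<close>.\<close>

definition test_spectrum :: "real \<Rightarrow> nat \<Rightarrow> real" where
  "test_spectrum a i = (if i = 0 then 1 else a)"

definition reflection :: "complex mat" where
  "reflection = mat 2 2 (\<lambda>(i, j). complex_of_real (if i = 1 \<and> j = 1 then - 1 / sqrt 2 else 1 / sqrt 2))"

definition test_A :: "real \<Rightarrow> complex mat" where
  "test_A a = rdiag 2 (test_spectrum a)"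

definition test_B :: "real \<Rightarrow> complex mat" where
  "test_B a = reflection * rdiag 2 (test_spectrum a) * reflection\<^sup>H"

lemma sum_lessThan_2: "(\<Sum>i<2. f i) = f 0 + f (1 :: nat)" for f :: "nat \<Rightarrow> 'a :: comm_monoid_add"
  by (simp add: numeral_2_eq_2)

lemma less_2_iff_0_1: "i < 2 \<longleftrightarrow> i = 0 \<or> i = (1 :: nat)"
  by auto

lemma of_real_sqrt_2_sq: "complex_of_real (sqrt 2) * complex_of_real (sqrt 2) = 2"
  by (simp flip: of_real_mult)

lemma reflection_unitary: "unitary 2 reflection"
  unfolding unitary_def
proof
  show "reflection\<^sup>H * reflection = 1\<^sub>m 2"
    by (rule eq_matI)
      (auto simp: reflection_def scalar_prod_def atLeast0LessThan sum_lessThan_2 less_2_iff_0_1 field_simps of_real_sqrt_2_sq)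
qed (simp add: reflection_def)

lemma rdiag_mult_one [simp]: "rdiag n d * 1\<^sub>m n = rdiag n d" "1\<^sub>m n * rdiag n d = rdiag n d"
  using right_mult_one_mat[of "rdiag n d" n n] left_mult_one_mat[of "rdiag n d" n n] by simp_all

lemma test_spectral: "spectral 2 (test_A a) (1\<^sub>m 2) (test_spectrum a)" "spectral 2 (test_B a) reflection (test_spectrum a)"
  by (simp_all add: spectral_def unitary_def[of _ "1\<^sub>m 2"] test_A_def test_B_def reflection_unitary)

lemma test_spectrum_powr: "test_spectrum a i powr r = test_spectrum (a powr r) i"
  by (simp add: test_spectrum_def)

lemma test_spectrum_decreasing: "0 \<le> a \<Longrightarrow> a \<le> 1 \<Longrightarrow> decreasing_nonneg n (test_spectrum a)"
  by (auto simp: decreasing_nonneg_def test_spectrum_def)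

lemma test_psd:
  assumes a: "0 < a" "a \<le> 1"
  shows "test_A a \<in> psd_mat 2" "test_B a \<in> psd_mat 2"
  by (rule spectral_psd[OF test_spectral(1)] spectral_psd[OF test_spectral(2)],
      use a in \<open>simp add: test_spectrum_def\<close>)+

text \<open>Powers stay inside the two families and only change the parameter, so the Riccati
  equation for the pair has the same shape for every exponent.\<close>

lemma test_powr:
  assumes a: "0 < a" "a \<le> 1"
  shows "test_A a ^\<^sub>M r = test_A (a powr r)" "test_B a ^\<^sub>M r = test_B (a powr r)"
  using a spectral_powr[OF test_spectral(1), of a r] spectral_powr[OF test_spectral(2), of a r]
  by (auto simp: test_spectrum_decreasing test_spectrum_powr spectral_def test_A_def test_B_def)

lemma test_one: "test_A 1 = 1\<^sub>m 2" "test_B 1 = 1\<^sub>m 2"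
proof -
  have d: "rdiag 2 (test_spectrum 1) = 1\<^sub>m 2" by (rule eq_matI) (auto simp: mat_diag_def test_spectrum_def)
  have "reflection \<in> carrier_mat 2 2" using unitary_carrier[OF reflection_unitary] .
  then show "test_A 1 = 1\<^sub>m 2" "test_B 1 = 1\<^sub>m 2"
    using unitary_right[OF reflection_unitary] by (simp_all add: test_A_def test_B_def d)
qed

text \<open>All entries of \<open>reflection\<close> have squared modulus 1/2, so each diagonal
  entry is the mean of the two eigenvalues.\<close>

lemma test_B_diag:
  assumes "i < 2"
  shows "test_B x $$ (i, i) = complex_of_real ((1 + x) / 2)"
proof -
  have "(cmod (reflection $$ (i, j)))\<^sup>2 = 1 / 2" if "j < 2" for j
    using that assms by (auto simp: reflection_def norm_divide power_divide)
  then have "(\<Sum>j<2. test_spectrum x j * (cmod (reflection $$ (i, j)))\<^sup>2) = (1 + x) / 2"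
    by (simp add: sum_lessThan_2 test_spectrum_def field_simps)
  then show ?thesis using spectral_diag[OF test_spectral(2) assms, of x] by (simp only:)
qed

lemma test_A_mult:
  assumes "M \<in> carrier_mat 2 2" "i < 2" "j < 2"
  shows "(test_A x * M) $$ (i, j) = test_spectrum x i * M $$ (i, j)"
    "(M * test_A x) $$ (i, j) = M $$ (i, j) * test_spectrum x j"
  using assms by (auto simp: test_A_def mat_diag_mult_left[of _ 2 2] mat_diag_mult_right[of _ 2 2])

lemma test_A_carrier [simp]: "test_A x \<in> carrier_mat 2 2" "dim_row (test_A x) = 2" "dim_col (test_A x) = 2"
  by (simp_all add: test_A_def mat_diag_def)

lemma test_det: "det (test_A x) = complex_of_real x" "det (test_B x) = complex_of_real x"
  using spectral_det[OF test_spectral(1), of x] spectral_det[OF test_spectral(2), of x]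
  by (simp_all add: test_spectrum_def numeral_2_eq_2)

text \<open>The point is uniformity in \<open>x\<close>. The determinant and the two diagonal
  entries of the equation control the trace of \<open>G\<close>, which dominates its largest
  eigenvalue.\<close>

lemma riccati_trace_bound:
  assumes G: "G \<in> psd_mat 2" and eq: "G * test_A x * G = test_B x" and x: "0 < x" "x \<le> 1"
  shows "eigprod 1 G \<le> 8"
proof -
  have Gc: "G \<in> carrier_mat 2 2" using G by simp
  define g l h where "g = Re (G $$ (0, 0))" "l = Re (G $$ (1, 1))" "h = (cmod (G $$ (0, 1)))\<^sup>2"
  have diag: "G $$ (0, 0) = complex_of_real g" "0 \<le> g" "G $$ (1, 1) = complex_of_real l" "0 \<le> l"
    using psd_diag_nonneg[OF G, of 0] psd_diag_nonneg[OF G, of 1]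
    by (auto simp: g_l_h_def less_eq_complex_def complex_eq_iff)
  have "G $$ (1, 0) = G\<^sup>H $$ (1, 0)" by (simp only: psd_hermitian[OF G])
  then have G10: "G $$ (1, 0) = cnj (G $$ (0, 1))" using Gc by simp
  have off: "G $$ (0, 1) * G $$ (1, 0) = complex_of_real h" "G $$ (1, 0) * G $$ (0, 1) = complex_of_real h"
    unfolding G10 g_l_h_def by (simp_all add: complex_norm_square mult.commute del: of_real_power)
  have det: "det G = complex_of_real (g * l - h)" unfolding det_2x2[OF Gc] diag off by simp
  have "0 \<le> g * l - h"
    using eigprod_full[OF G] eigprod_nonneg[OF G, of 2] by (simp add: det del: of_real_diff of_real_mult)
  moreover have "(g * l - h)\<^sup>2 * x = x"
  proof -
    have "det (G * test_A x * G) = complex_of_real x" by (simp add: eq test_det)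
    then have "complex_of_real ((g * l - h) * x * (g * l - h)) = complex_of_real x"
      using Gc by (simp add: det_mult[of _ 2] det test_det)
    then show ?thesis by (simp only: of_real_eq_iff power2_eq_square mult_ac)
  qed
  \<comment> \<open>The equation determines det G only up to sign; positivity of \<open>G\<close>
    selects +1.\<close>
  ultimately have d1: "g * l - h = 1" using x by (simp add: power2_eq_1_iff)
  have entry: "(G * test_A x * G) $$ (i, i) = (\<Sum>j<2. G $$ (i, j) * test_spectrum x j * G $$ (j, i))" if "i < 2" for i
  proof -
    have "(M * G) $$ (i, i) = (\<Sum>j<2. M $$ (i, j) * G $$ (j, i))" if "M \<in> carrier_mat 2 2" for M
      using that Gc \<open>i < 2\<close> by (simp add: scalar_prod_def atLeast0LessThan)
    then have "(G * test_A x * G) $$ (i, i) = (\<Sum>j<2. (G * test_A x) $$ (i, j) * G $$ (j, i))"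
      using Gc by simp
    also have "\<dots> = (\<Sum>j<2. G $$ (i, j) * test_spectrum x j * G $$ (j, i))"
      using Gc that by (intro sum.cong) (auto simp: test_A_mult simp del: index_mult_mat(1))
    finally show ?thesis .
  qed
  have e0: "g * g + x * h = (1 + x) / 2"
  proof -
    have "complex_of_real (g * g + x * h) = (G * test_A x * G) $$ (0, 0)"
      using off(1) by (simp add: entry sum_lessThan_2 diag test_spectrum_def mult_ac del: One_nat_def)
    also have "\<dots> = complex_of_real ((1 + x) / 2)" unfolding eq by (rule test_B_diag) simp
    finally show ?thesis by (simp only: of_real_eq_iff)
  qed
  have e1: "h + x * (l * l) = (1 + x) / 2"
  proof -
    have "complex_of_real (h + x * (l * l)) = (G * test_A x * G) $$ (1, 1)"
      using off(2) by (simp add: entry sum_lessThan_2 diag test_spectrum_def mult_ac del: One_nat_def)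
    also have "\<dots> = complex_of_real ((1 + x) / 2)" unfolding eq by (rule test_B_diag) simp
    finally show ?thesis by (simp only: of_real_eq_iff)
  qed
  \<comment> \<open>The trace of \<open>G * test_A x\<close>. Multiplying \<open>g\<close> and
    \<open>l\<close> by it makes the quadratic relations \<open>e0\<close>, \<open>e1\<close> and
    \<open>d1\<close> linear in \<open>x\<close>.\<close>
  define \<tau> where "\<tau> = g + x * l"
  have \<tau>0: "0 \<le> \<tau>" using diag x by (simp add: \<tau>_def)
  have \<tau>g: "\<tau> * g = (1 + 3 * x) / 2"
  proof -
    have "\<tau> * g = (g * g + x * h) + x * (g * l - h)" by (simp add: \<tau>_def algebra_simps)
    then show ?thesis unfolding e0 d1 by (simp add: field_simps)
  qed
  have \<tau>l: "\<tau> * l = (3 + x) / 2"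
  proof -
    have "\<tau> * l = (h + x * (l * l)) + (g * l - h)" by (simp add: \<tau>_def algebra_simps)
    then show ?thesis unfolding e1 d1 by (simp add: field_simps)
  qed
  have "\<tau> * \<tau> = \<tau> * g + x * (\<tau> * l)" by (simp add: \<tau>_def algebra_simps)
  also have "\<dots> \<ge> 1 / 2" unfolding \<tau>g \<tau>l using x by (simp add: field_simps)
  finally have "(1 / 2)\<^sup>2 \<le> \<tau>\<^sup>2" by (simp add: power2_eq_square)
  then have \<tau>: "1 / 2 \<le> \<tau>" by (rule power2_le_imp_le[OF _ \<tau>0])
  \<comment> \<open>Since \<tau> (g + l) = 2 + 2 x is at most 4 and \<tau> is at least 1/2, the
    trace is at most 8.\<close>
  have "1 / 2 * (g + l) \<le> \<tau> * (g + l)" using \<tau> diag by (intro mult_right_mono) auto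
  also have "\<dots> = (4 + 4 * x) / 2" using \<tau>g \<tau>l by (simp add: distrib_left)
  finally have "g + l \<le> 8" using x by simp
  moreover have "eigprod 1 G \<le> g + l"
    using eigprod_1_le_trace[OF G] by (simp add: sum_lessThan_2 g_l_h_def)
  ultimately show ?thesis by simp
qed

text \<open>A bound free of \<open>a\<close>: the geometric mean solves the Riccati equation with
  parameter \<open>a powr p\<close>, hence has norm at most 8, and the power of
  \<open>test_A a\<close> has norm 1.\<close>

lemma test_SG_bound:
  assumes a: "0 < a" "a \<le> 1" and p: "0 < p" and \<alpha>: "0 < \<alpha>"
  shows "eigprod 1 (SG_mean \<alpha> p (test_A a) (test_B a)) \<le> 8 powr (\<alpha> * (2 * (1 / p)))"
proof -
  note A = test_psd(1)[OF a] and B = test_psd(2)[OF a]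
  have supp: "test_A a ^\<^sub>M 0 * test_B a = test_B a"
    using left_mult_one_mat[OF psd_carrier[OF B]] a by (simp add: test_powr[OF a] test_one)
  define G where "G = test_A a ^\<^sub>M (- p) #\<^sub>M test_B a ^\<^sub>M p"
  note G = geom_mean_riccati[OF A B supp, of p, folded G_def]
  define S where "S = test_A a ^\<^sub>M (p / 2) * G ^\<^sub>M \<alpha>"
  have S: "S \<in> carrier_mat 2 2" using A G(1) by (simp add: S_def)
  have nn: "0 \<le> ext_norm 1 S" "0 \<le> ext_norm 1 G" using S G(1) by (auto intro: ext_norm_nonneg[of _ 2])
  have Gb: "ext_norm 1 G \<le> 8"
  proof -
    have "0 < a powr p" "a powr p \<le> 1" using a p by (auto intro: powr_le1)
    then show ?thesis
      using riccati_trace_bound[OF G(1), of "a powr p"] G(3) ext_norm_psd[OF G(1), of 1] by (simp add: test_powr[OF a])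
  qed
  have "ext_norm 1 (test_A a ^\<^sub>M (p / 2)) = 1"
    using ext_norm_psd[OF psd_powr[OF A, of "p / 2"], of 1]
      spectral_eigprod[OF test_spectral(1)[of "a powr (p / 2)"] test_spectrum_decreasing, of 1] a p
    by (simp add: test_powr[OF a] powr_le1 test_spectrum_def)
  then have "ext_norm 1 S \<le> 1 * ext_norm 1 G powr \<alpha>"
    using ext_norm_mult[of "test_A a ^\<^sub>M (p / 2)" 2 "G ^\<^sub>M \<alpha>" 1] A G(1) \<alpha>
    by (simp add: S_def ext_norm_powr[of _ 2])
  also have "\<dots> \<le> 8 powr \<alpha>" using Gb nn \<alpha> by (simp add: powr_mono2)
  finally have Sb: "ext_norm 1 S \<le> 8 powr \<alpha>" .
  have "eigprod 1 (SG_mean \<alpha> p (test_A a) (test_B a)) = ext_norm 1 S powr (2 * (1 / p))"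
    unfolding SG_mean_eq_gram[OF A B supp] S_def G_def using A G(1) p
    by (intro eigprod_gram_powr[of _ 2]) (auto simp: G_def)
  also have "\<dots> \<le> (8 powr \<alpha>) powr (2 * (1 / p))" using Sb nn p by (intro powr_mono2) auto
  finally show ?thesis by (simp add: powr_powr)
qed

text \<open>Test the largest eigenvalue against the lower diagonal entry, where
  \<open>test_B\<close> contributes at least 1/2 and the powers of \<open>test_A a\<close>
  contribute \<open>a powr ((1 - \<alpha>) * q)\<close>. This blows up as \<open>a\<close> tends to
  0 when \<alpha> > 1.\<close>

lemma test_Renyi_bound:
  assumes a: "0 < a" "a \<le> 1" and q: "0 < q"
  shows "a powr (1 - \<alpha>) * (1 / 2) powr (1 / q) \<le> eigprod 1 (Renyi_mean \<alpha> q (test_A a) (test_B a))"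
proof -
  note A = test_psd(1)[OF a] and B = test_psd(2)[OF a]
  define s where "s = (1 - \<alpha>) / 2 * q"
  define W where "W = test_A a ^\<^sub>M s * test_B a ^\<^sub>M (\<alpha> * q) * test_A a ^\<^sub>M s"
  have W: "W \<in> psd_mat 2"
    using psd_congruence[OF psd_powr[OF B, of "\<alpha> * q"] powr_carrier[OF A, of s]] A by (simp add: W_def)
  have Bc: "test_B x \<in> carrier_mat 2 2" for x by (rule spectral_carrier[OF test_spectral(2)])
  have "W $$ (1, 1) = complex_of_real (a powr s * ((1 + a powr (\<alpha> * q)) / 2) * a powr s)"
    using Bc unfolding W_def test_powr[OF a]
    by (simp add: test_A_mult test_B_diag test_spectrum_def del: index_mult_mat(1))
  also have "a powr s * ((1 + a powr (\<alpha> * q)) / 2) * a powr s = a powr ((1 - \<alpha>) * q) * ((1 + a powr (\<alpha> * q)) / 2)"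
    by (simp add: s_def mult_ac flip: powr_add)
  finally have "a powr ((1 - \<alpha>) * q) * ((1 + a powr (\<alpha> * q)) / 2) \<le> eigprod 1 W"
    using diag_le_eigprod_1[OF W, of 1] by (simp only: Re_complex_of_real one_less_numeral_iff semiring_norm)
  moreover have "a powr ((1 - \<alpha>) * q) * (1 / 2) \<le> a powr ((1 - \<alpha>) * q) * ((1 + a powr (\<alpha> * q)) / 2)"
    by (intro mult_left_mono) auto
  ultimately have "(a powr ((1 - \<alpha>) * q) * (1 / 2)) powr (1 / q) \<le> eigprod 1 W powr (1 / q)"
    using q by (intro powr_mono2) auto
  moreover have "(a powr ((1 - \<alpha>) * q) * (1 / 2)) powr (1 / q) = a powr (1 - \<alpha>) * (1 / 2) powr (1 / q)"
    using q by (subst powr_mult) (auto simp: powr_powr)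
  moreover have "eigprod 1 W powr (1 / q) = eigprod 1 (Renyi_mean \<alpha> q (test_A a) (test_B a))"
    unfolding Renyi_mean_def s_def[symmetric] W_def[symmetric] using q by (simp add: eigprod_powr[OF W])
  ultimately show ?thesis by simp
qed

lemma Renyi_not_log_majorized_SG:
  assumes \<alpha>: "\<alpha> > 1" and p: "p > 0" and q: "q > 0"
  shows "\<exists>A \<in> pd_mat 2. \<exists>B \<in> pd_mat 2. \<not> Renyi_mean \<alpha> q A B \<prec>\<^sub>l\<^sub>o\<^sub>g SG_mean \<alpha> p A B"
proof -
  \<comment> \<open>\<open>a\<close> is chosen so that \<open>a powr (1 - \<alpha>)\<close> is
    \<open>C\<close>. The factor \<open>2 powr (1 / q)\<close> offsets the 1/2 in the lower bound;
    the summand 1 makes the inequality strict and gives C > 1, hence a \<le> 1.\<close>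
  define C where "C = 8 powr (\<alpha> * (2 * (1 / p))) * 2 powr (1 / q) + 1"
  define a where "a = C powr (1 / (1 - \<alpha>))"
  have C: "1 < C" by (simp add: C_def)
  have a: "0 < a" "a \<le> 1" using C \<alpha> powr_mono[of "1 / (1 - \<alpha>)" 0 C] by (auto simp: a_def)
  have "a powr (1 - \<alpha>) = C" using C \<alpha> by (simp add: a_def powr_powr)
  then have "8 powr (\<alpha> * (2 * (1 / p))) < a powr (1 - \<alpha>) * (1 / 2) powr (1 / q)"
    by (simp add: C_def powr_divide field_simps)
  then have lt: "eigprod 1 (SG_mean \<alpha> p (test_A a) (test_B a)) < eigprod 1 (Renyi_mean \<alpha> q (test_A a) (test_B a))"
    using test_SG_bound[OF a p, of \<alpha>] test_Renyi_bound[OF a q, of \<alpha>] \<alpha> by simp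
  note A = test_psd(1)[OF a] and B = test_psd(2)[OF a]
  have id: "test_A a ^\<^sub>M 0 = 1\<^sub>m 2" "test_B a ^\<^sub>M 0 = 1\<^sub>m 2" using a by (simp_all add: test_powr[OF a] test_one)
  then have "test_A a ^\<^sub>M 0 * test_B a = test_B a" using left_mult_one_mat[OF psd_carrier[OF B]] by simp
  then have "dim_row (Renyi_mean \<alpha> q (test_A a) (test_B a)) = 2"
    using psd_carrier[OF mean_psd(2)[OF A B]] by auto
  then have "\<not> Renyi_mean \<alpha> q (test_A a) (test_B a) \<prec>\<^sub>l\<^sub>o\<^sub>g SG_mean \<alpha> p (test_A a) (test_B a)"
    \<comment> \<open>The inequality for the largest eigenvalue, k = 1, already fails.\<close>
    using lt by (auto simp: log_majorized_def eigprod_def intro!: bexI[of _ 1])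
  then show ?thesis using psd_pd[OF A id(1)] psd_pd[OF B id(2)] by blast
qed

theorem theorem3p4:
  fixes \<alpha> p q :: real
  assumes "\<alpha> > 1" and "p > 0" and "q > 0"
  shows "(p / q \<le> \<alpha> \<longrightarrow>
           (\<forall>n. \<forall>A \<in> psd_mat n. \<forall>B \<in> psd_mat n.
              support_ge A B \<longrightarrow> SG_mean \<alpha> p A B \<prec>\<^sub>l\<^sub>o\<^sub>g Renyi_mean \<alpha> q A B)) \<and>
         (\<exists>A \<in> pd_mat 2. \<exists>B \<in> pd_mat 2.
              \<not> Renyi_mean \<alpha> q A B \<prec>\<^sub>l\<^sub>o\<^sub>g SG_mean \<alpha> p A B)"
  using SG_log_majorized_Renyi Renyi_not_log_majorized_SG assms by blast

end
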